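(* Let $r$, $P$ and $W$ be Lipschitz continuous (with constants $L_r,L_P,L_W>0$). Then there exists an $L^p$ graphon mean field equilibrium (GMFE) $(\boldsymbol\pi,\boldsymbol\mu)\in\boldsymbol\Pi\times\boldsymbol{\mathcal M}$, i.e. a pair with $\boldsymbol\mu=\Psi(\boldsymbol\pi)$ and $\pi^\alpha\in\arg\max_{\pi\in\Pi}J^{\boldsymbol\mu}_\alpha(\pi)$ for every $\alpha\in[0,1]$.
   Context: Let $\mathcal X,\mathcal U$ be finite sets (states, actions), $T\in\mathbb N$, $\mathcal T=\{0,\dots,T-1\}$, $\mathcal I=[0,1]$. For a finite set $A$, $\mathcal P(A)$ is the set of probability measures and $\mathcal B(A)$ the set of bounded nonnegative measures on $A$, identified with vectors in $\mathbb R^{|A|}$ with the $\ell_1$ norm. Fix a transition kernel $P:\mathcal X\times\mathcal U\times\mathcal B(\mathcal X)\to\mathcal P(\mathcal X)$, a reward $r:\mathcal X\times\mathcal U\times\mathcal B(\mathcal X)\to\mathbb R$, an initial law $\mu_0\in\mathcal P(\mathcal X)$, and a graphon $W:[0,1]^2\to[0,\infty)$ (symmetric, measurable, integrable). Policies: $\Pi=\mathcal P(\mathcal U)^{\mathcal T\times\mathcal X}$, written $\pi_t(u\mid x)$. Policy ensembles $\boldsymbol\Pi$: families $(\pi^\alpha)_{\alpha\in\mathcal I}$ with $\alpha\mapsto\pi^\alpha_t(u\mid x)$ measurable for all $t,u,x$. Mean field ensembles $\boldsymbol{\mathcal M}$: families $(\mu^\alpha_t)_{\alpha\in\mathcal I,t}$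 of elements of $\mathcal P(\mathcal X)$ with $\alpha\mapsto\mu^\alpha_t(x)$ measurable; $\boldsymbol\mu_t=(\mu^\alpha_t)_\alpha$. Neighborhood mean field: $\mathbb G^\alpha(\boldsymbol\mu_t)=\int_{\mathcal I}W(\alpha,\beta)\mu^\beta_t\,d\beta\in\mathcal B(\mathcal X)$. $\Psi(\boldsymbol\pi)=\boldsymbol\mu$ is defined recursively by $\mu^\alpha_0=\mu_0$, $\mu^\alpha_{t+1}(x)=\sum_{x'}\mu^\alpha_t(x')\sum_u\pi^\alpha_t(u\mid x')P(x\mid x',u,\mathbb G^\alpha(\boldsymbol\mu_t))$. For $\boldsymbol\mu\in\boldsymbol{\mathcal M}$, $\alpha\in\mathcal I$, $\pi\in\Pi$: $J^{\boldsymbol\mu}_\alpha(\pi)=\mathbb E[\sum_{t=0}^{T-1}r(X_t,U_t,\mathbb G^\alpha(\boldsymbol\mu_t))]$ where $X_0\sim\mu_0$, $U_t\sim\pi_t(\cdot\mid X_t)$, $X_{t+1}\sim P(\cdot\mid X_t,U_t,\mathbb G^\alpha(\boldsymbol\mu_t))$. Lipschitz continuity of $P$ and $r$ refers to all arguments jointly (discrete metric on $\mathcal X,\mathcal U$, $\ell_1$ on $\mathcal B(\mathcal X)$, $\ell_1$/total variation on outputs of $P$). *)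

theory Defs
  imports "HOL-Analysis.Analysis"
begin

text \<open>Measures on a finite set identified with real vectors (functions).\<close>

definition prob_vec :: "('a::finite \<Rightarrow> real) \<Rightarrow> bool" where
  "prob_vec v \<longleftrightarrow> (\<forall>a. 0 \<le> v a) \<and> (\<Sum>a\<in>UNIV. v a) = 1"

definition bmeas_vec :: "('a::finite \<Rightarrow> real) \<Rightarrow> bool" where
  "bmeas_vec v \<longleftrightarrow> (\<forall>a. 0 \<le> v a)"

definition l1_norm :: "('a::finite \<Rightarrow> real) \<Rightarrow> real" where
  "l1_norm v = (\<Sum>a\<in>UNIV. \<bar>v a\<bar>)"

definition ddist :: "'a \<Rightarrow> 'a \<Rightarrow> real" where
  "ddist a b = (if a = b then 0 else 1)"

definition reward_lipschitz ::
  "real \<Rightarrow> ('x::finite \<Rightarrow> 'u::finite \<Rightarrow> ('x \<Rightarrow> real) \<Rightarrow> real) \<Rightarrow> bool" where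
  "reward_lipschitz L r \<longleftrightarrow>
     (\<forall>x u g x' u' g'. bmeas_vec g \<longrightarrow> bmeas_vec g' \<longrightarrow>
        \<bar>r x u g - r x' u' g'\<bar> \<le> L * (ddist x x' + ddist u u' + l1_norm (\<lambda>y. g y - g' y)))"

definition kernel_lipschitz ::
  "real \<Rightarrow> ('x::finite \<Rightarrow> 'u::finite \<Rightarrow> ('x \<Rightarrow> real) \<Rightarrow> ('x \<Rightarrow> real)) \<Rightarrow> bool" where
  "kernel_lipschitz L P \<longleftrightarrow>
     (\<forall>x u g x' u' g'. bmeas_vec g \<longrightarrow> bmeas_vec g' \<longrightarrow>
        l1_norm (\<lambda>y. P x u g y - P x' u' g' y)
          \<le> L * (ddist x x' + ddist u u' + l1_norm (\<lambda>y. g y - g' y)))"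

definition graphon :: "(real \<Rightarrow> real \<Rightarrow> real) \<Rightarrow> bool" where
  "graphon W \<longleftrightarrow>
     (\<forall>a\<in>{0..1}. \<forall>b\<in>{0..1}. W a b = W b a \<and> 0 \<le> W a b) \<and>
     set_borel_measurable lborel ({0..1} \<times> {0..1}) (\<lambda>p. W (fst p) (snd p)) \<and>
     set_integrable lborel ({0..1} \<times> {0..1}) (\<lambda>p. W (fst p) (snd p))"

definition is_policy :: "nat \<Rightarrow> (nat \<Rightarrow> 'x::finite \<Rightarrow> 'u::finite \<Rightarrow> real) \<Rightarrow> bool" where
  "is_policy T pol \<longleftrightarrow> (\<forall>t<T. \<forall>x. prob_vec (pol t x))"

definition is_policy_ensemble ::
  "nat \<Rightarrow> (real \<Rightarrow> nat \<Rightarrow> 'x::finite \<Rightarrow> 'u::finite \<Rightarrow> real) \<Rightarrow> bool" where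
  "is_policy_ensemble T pis \<longleftrightarrow>
     (\<forall>\<alpha>\<in>{0..1}. is_policy T (pis \<alpha>)) \<and>
     (\<forall>t<T. \<forall>x u. (\<lambda>\<alpha>. pis \<alpha> t x u) \<in> borel_measurable (restrict_space lborel {0..1}))"

definition is_mf_ensemble :: "nat \<Rightarrow> (real \<Rightarrow> nat \<Rightarrow> 'x::finite \<Rightarrow> real) \<Rightarrow> bool" where
  "is_mf_ensemble T mus \<longleftrightarrow>
     (\<forall>\<alpha>\<in>{0..1}. \<forall>t<T. prob_vec (mus \<alpha> t)) \<and>
     (\<forall>t<T. \<forall>x. (\<lambda>\<alpha>. mus \<alpha> t x) \<in> borel_measurable (restrict_space lborel {0..1}))"

definition nbhd :: "(real \<Rightarrow> real \<Rightarrow> real) \<Rightarrow> (real \<Rightarrow> 'x \<Rightarrow> real) \<Rightarrow> real \<Rightarrow> 'x \<Rightarrow> real" where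
  "nbhd W m \<alpha> = (\<lambda>x. LINT \<beta>:{0..1}|lborel. W \<alpha> \<beta> * m \<beta> x)"

primrec psi_mf ::
  "(real \<Rightarrow> real \<Rightarrow> real) \<Rightarrow> ('x::finite \<Rightarrow> 'u::finite \<Rightarrow> ('x \<Rightarrow> real) \<Rightarrow> ('x \<Rightarrow> real))
   \<Rightarrow> ('x \<Rightarrow> real) \<Rightarrow> (real \<Rightarrow> nat \<Rightarrow> 'x \<Rightarrow> 'u \<Rightarrow> real) \<Rightarrow> nat \<Rightarrow> real \<Rightarrow> 'x \<Rightarrow> real" where
  "psi_mf W P mu0 pis 0 = (\<lambda>\<alpha>. mu0)"
| "psi_mf W P mu0 pis (Suc t) =
     (\<lambda>\<alpha> x. \<Sum>x'\<in>UNIV. psi_mf W P mu0 pis t \<alpha> x' *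
        (\<Sum>u\<in>UNIV. pis \<alpha> t x' u * P x' u (nbhd W (psi_mf W P mu0 pis t) \<alpha>) x))"

primrec agent_law ::
  "(real \<Rightarrow> real \<Rightarrow> real) \<Rightarrow> ('x::finite \<Rightarrow> 'u::finite \<Rightarrow> ('x \<Rightarrow> real) \<Rightarrow> ('x \<Rightarrow> real))
   \<Rightarrow> ('x \<Rightarrow> real) \<Rightarrow> (real \<Rightarrow> nat \<Rightarrow> 'x \<Rightarrow> real) \<Rightarrow> real \<Rightarrow> (nat \<Rightarrow> 'x \<Rightarrow> 'u \<Rightarrow> real)
   \<Rightarrow> nat \<Rightarrow> 'x \<Rightarrow> real" where
  "agent_law W P mu0 mus \<alpha> pol 0 = mu0"
| "agent_law W P mu0 mus \<alpha> pol (Suc t) =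
     (\<lambda>x. \<Sum>x'\<in>UNIV. agent_law W P mu0 mus \<alpha> pol t x' *
        (\<Sum>u\<in>UNIV. pol t x' u * P x' u (nbhd W (\<lambda>\<beta>. mus \<beta> t) \<alpha>) x))"

text \<open>Objective J^mu_alpha(pol) = E[sum_{t<T} r(X_t,U_t,G^alpha(mu_t))], written out
  via the marginal laws of (X_t,U_t).\<close>
definition J_obj ::
  "(real \<Rightarrow> real \<Rightarrow> real) \<Rightarrow> ('x::finite \<Rightarrow> 'u::finite \<Rightarrow> ('x \<Rightarrow> real) \<Rightarrow> ('x \<Rightarrow> real))
   \<Rightarrow> ('x \<Rightarrow> 'u \<Rightarrow> ('x \<Rightarrow> real) \<Rightarrow> real) \<Rightarrow> ('x \<Rightarrow> real) \<Rightarrow> nat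
   \<Rightarrow> (real \<Rightarrow> nat \<Rightarrow> 'x \<Rightarrow> real) \<Rightarrow> real \<Rightarrow> (nat \<Rightarrow> 'x \<Rightarrow> 'u \<Rightarrow> real) \<Rightarrow> real" where
  "J_obj W P r mu0 T mus \<alpha> pol =
     (\<Sum>t<T. \<Sum>x\<in>UNIV. agent_law W P mu0 mus \<alpha> pol t x *
        (\<Sum>u\<in>UNIV. pol t x u * r x u (nbhd W (\<lambda>\<beta>. mus \<beta> t) \<alpha>)))"

definition is_GMFE ::
  "(real \<Rightarrow> real \<Rightarrow> real) \<Rightarrow> ('x::finite \<Rightarrow> 'u::finite \<Rightarrow> ('x \<Rightarrow> real) \<Rightarrow> ('x \<Rightarrow> real))
   \<Rightarrow> ('x \<Rightarrow> 'u \<Rightarrow> ('x \<Rightarrow> real) \<Rightarrow> real) \<Rightarrow> ('x \<Rightarrow> real) \<Rightarrow> nat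
   \<Rightarrow> (real \<Rightarrow> nat \<Rightarrow> 'x \<Rightarrow> 'u \<Rightarrow> real) \<Rightarrow> (real \<Rightarrow> nat \<Rightarrow> 'x \<Rightarrow> real) \<Rightarrow> bool" where
  "is_GMFE W P r mu0 T pis mus \<longleftrightarrow>
     is_policy_ensemble T pis \<and> is_mf_ensemble T mus \<and>
     (\<forall>\<alpha>\<in>{0..1}. \<forall>t<T. mus \<alpha> t = psi_mf W P mu0 pis t \<alpha>) \<and>
     (\<forall>\<alpha>\<in>{0..1}. \<forall>pol. is_policy T pol \<longrightarrow>
        J_obj W P r mu0 T mus \<alpha> pol \<le> J_obj W P r mu0 T mus \<alpha> (pis \<alpha>))"

end

theory Submission
  imports Defs
begin

text \<open>
  Fix a tentative flow of neighbourhood mean fields. The best responses against it need not be unique,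
  so the exact optimal policy is replaced by one that mixes, continuously in the flow, over the actions
  whose optimality gap is below \<open>\<epsilon>\<close>. Sampling the flow on a grid of \<open>[0,1]\<close> makes the resulting
  self-map finite-dimensional, and Brouwer's theorem yields flows that reproduce themselves up to
  \<open>\<epsilon>\<close>, because \<open>W\<close> is Lipschitz.

  As \<open>\<epsilon>\<close> tends to \<open>0\<close>, the state-action laws \<open>\<mu>\<^sub>t(x) \<pi>\<^sub>t(u | x)\<close>, being \<open>[0,1]\<close>-valued functions of
  \<open>\<alpha>\<close>, converge weakly along a subsequence. Integration against \<open>W(\<alpha>, _)\<close> turns this into pointwise
  convergence of the neighbourhood flows. The forward equation and the condition that mass times
  optimality gap vanishes are linear in the state-action law, with coefficients that depend only on
  the neighbourhood flow, so both survive in the limit for almost every \<open>\<alpha>\<close>. Disintegrating the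
  limit gives the equilibrium policies; on the exceptional null set, and at states of mass zero, they
  are replaced by a uniform choice among the optimal actions, which changes no neighbourhood integral.
\<close>

section \<open>Brouwer's theorem on finite cubes\<close>

text \<open>Tychonoff's theorem makes the cube compact in the product topology; countability of the
  index type makes that topology metrizable, so compactness yields subsequences. This takes the
  place of a diagonal argument, both for the grid points in Brouwer's theorem and for weak
  compactness.\<close>

lemma bounded_pointwise_convergent_subseq:
  fixes f :: "nat \<Rightarrow> 'k::countable \<Rightarrow> real"
  assumes "\<And>n k. f n k \<in> {0..1}"
  obtains l \<sigma> where "strict_mono (\<sigma> :: nat \<Rightarrow> nat)" "\<And>k. l k \<in> {0..1}"
    "\<And>k. (\<lambda>n. f (\<sigma> n) k) \<longlonglongrightarrow> l k"
proof -
  have "compact (PiE (UNIV::'k set) (\<lambda>_. {0..1::real}))"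
    unfolding compactin_euclidean_iff[symmetric] euclidean_product_topology[symmetric]
    by (auto simp: compactin_PiE)
  then have "seq_compact (PiE (UNIV::'k set) (\<lambda>_. {0..1::real}))"
    by (simp add: compact_eq_seq_compact_metric)
  moreover have "\<forall>n. f n \<in> PiE (UNIV::'k set) (\<lambda>_. {0..1::real})"
    using assms by auto
  ultimately have "\<exists>l\<in>PiE UNIV (\<lambda>_. {0..1::real}). \<exists>\<sigma>. strict_mono (\<sigma> :: nat \<Rightarrow> nat) \<and> (f \<circ> \<sigma>) \<longlonglongrightarrow> l"
    unfolding seq_compact_def by (elim allE[of _ f]) blast
  then obtain l \<sigma> where *: "l \<in> PiE UNIV (\<lambda>_. {0..1::real})" "strict_mono (\<sigma> :: nat \<Rightarrow> nat)"
      "(f \<circ> \<sigma>) \<longlonglongrightarrow> l"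
    by blast
  have "(\<lambda>n. f (\<sigma> n) k) \<longlonglongrightarrow> l k" for k
  proof -
    have "isCont (\<lambda>x::'k \<Rightarrow> real. x k) l"
      using continuous_on_product_coordinates by (rule continuous_on_interior) simp
    then show ?thesis
      using isCont_tendsto_compose[OF _ *(3), of "\<lambda>x. x k"] by (simp add: o_def)
  qed
  with * show thesis by (intro that[of \<sigma> l]) auto
qed

text \<open>Stated for functions on an arbitrary finite index set with sequential continuity,
  because the unknowns later are indexed by triples (cell, time, state) whose number grows as
  \<epsilon> shrinks. Kuhn's combinatorial lemma is applied on ever finer grids, and a limit of the
  small cubes it finds is a fixed point.\<close>

theorem brouwer_finite_cube:
  fixes f :: "('i \<Rightarrow> real) \<Rightarrow> 'i \<Rightarrow> real"
  assumes fin: "finite I"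
    and maps: "\<And>z i. (\<And>j. j \<in> I \<Longrightarrow> z j \<in> {0..1}) \<Longrightarrow> i \<in> I \<Longrightarrow> f z i \<in> {0..1}"
    and cont: "\<And>zs z i. (\<And>(n::nat) j. j \<in> I \<Longrightarrow> zs n j \<in> {0..1}) \<Longrightarrow>
       (\<And>j. j \<in> I \<Longrightarrow> z j \<in> {0..1}) \<Longrightarrow>
       (\<And>j. j \<in> I \<Longrightarrow> (\<lambda>n. zs n j) \<longlonglongrightarrow> z j) \<Longrightarrow> i \<in> I \<Longrightarrow> (\<lambda>n. f (zs n) i) \<longlonglongrightarrow> f z i"
  obtains z where "\<And>i. i \<in> I \<Longrightarrow> z i \<in> {0..1}" "\<And>i. i \<in> I \<Longrightarrow> f z i = z i"
proof -
  define n where "n = card I"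
  obtain e where e: "bij_betw e {0..<n} I"
    using ex_bij_betw_nat_finite[OF fin] n_def by blast
  \<comment> \<open>\<open>e\<close> numbers the coordinates in \<open>I\<close> by naturals below
    \<open>n\<close>, as Kuhn's lemma expects; \<open>d\<close> is its inverse.\<close>
  define d where "d = inv_into {0..<n} e"
  have d: "d i < n" "e (d i) = i" if "i \<in> I" for i
    using that e bij_betw_inv_into[OF e] bij_betwE[of d I "{0..<n}"] unfolding d_def
    by (auto simp: bij_betw_inv_into_right)
  have e_mem: "e k \<in> I" if "k < n" for k
    using that bij_betwE[OF e] by auto
  define pt :: "nat \<Rightarrow> (nat \<Rightarrow> nat) \<Rightarrow> 'i \<Rightarrow> real" where "pt p x i = real (x (d i)) / real p" for p x i
  have pt01: "pt p x i \<in> {0..1}" if "\<And>k. k < n \<Longrightarrow> x k \<le> p" "i \<in> I" for p x i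
    using that(1)[OF d(1)[OF that(2)]] by (auto simp: pt_def divide_le_eq_1)
  \<comment> \<open>Label 0 certifies that \<open>f\<close> does not lower coordinate
    \<open>k\<close> at this grid point, label 1 that it does not raise it. The labels on the faces
    are those prescribed by Kuhn's lemma; they keep this meaning because \<open>f\<close> maps the
    cube into itself.\<close>
  define lab :: "nat \<Rightarrow> (nat \<Rightarrow> nat) \<Rightarrow> nat \<Rightarrow> nat" where
    "lab p x k = (if x k = 0 then 0 else if x k = p then 1
                  else if real (x k) / p \<le> f (pt p x) (e k) then 0 else 1)" for p x k
  have lab0: "real (x k) / p \<le> f (pt p x) (e k)"
    if "lab p x k = 0" "\<And>k. k < n \<Longrightarrow> x k \<le> p" "k < n" for p x k
    using that(1) maps[OF pt01[OF that(2)] e_mem[OF that(3)]]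
    by (auto simp: lab_def split: if_splits)
  have lab1: "f (pt p x) (e k) \<le> real (x k) / p"
    if "lab p x k = 1" "\<And>k. k < n \<Longrightarrow> x k \<le> p" "k < n" for p x k
    using that(1) maps[OF pt01[OF that(2)] e_mem[OF that(3)]]
    by (auto simp: lab_def split: if_splits)
  \<comment> \<open>Kuhn's lemma gives, for each \<open>k\<close>, two vertices of one small cube
    whose labels differ in coordinate \<open>k\<close>. Swapping them if necessary, \<open>r\<close>
    carries label 0 and \<open>s\<close> carries label 1.\<close>
  have "\<exists>q. (\<forall>k<n. q k < Suc m) \<and> (\<forall>k<n. \<exists>r s. (\<forall>j<n. q j \<le> r j \<and> r j \<le> q j + 1) \<and>
      (\<forall>j<n. q j \<le> s j \<and> s j \<le> q j + 1) \<and> lab (Suc m) r k = 0 \<and> lab (Suc m) s k = 1)" for m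
  proof -
    obtain q where q: "\<forall>k<n. q k < Suc m"
      "\<forall>k<n. \<exists>r s. (\<forall>j<n. q j \<le> r j \<and> r j \<le> q j + 1) \<and>
      (\<forall>j<n. q j \<le> s j \<and> s j \<le> q j + 1) \<and> lab (Suc m) r k \<noteq> lab (Suc m) s k"
      by (rule kuhn_lemma[of "Suc m" n "lab (Suc m)"]) (auto simp: lab_def)
    have two: "lab (Suc m) x k = 0 \<or> lab (Suc m) x k = 1" for x k by (auto simp: lab_def)
    have sw: "\<exists>r s. (\<forall>j<n. q j \<le> r j \<and> r j \<le> q j + 1) \<and>
      (\<forall>j<n. q j \<le> s j \<and> s j \<le> q j + 1) \<and> lab (Suc m) r k = 0 \<and> lab (Suc m) s k = 1"
      if kn: "k < n" for k
    proof -
      obtain r s where rs: "\<forall>j<n. q j \<le> r j \<and> r j \<le> q j + 1" "\<forall>j<n. q j \<le> s j \<and> s j \<le> q j + 1"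
        "lab (Suc m) r k \<noteq> lab (Suc m) s k"
        using q(2)[rule_format, OF kn] by (elim exE conjE) (rule that)
      show ?thesis
      proof (cases "lab (Suc m) r k = 0")
        case True
        then have "lab (Suc m) s k = 1" using rs(3) two[of s k] by simp
        with True rs show ?thesis by (intro exI[of _ r] exI[of _ s] conjI)
      next
        case False
        then have "lab (Suc m) r k = 1" "lab (Suc m) s k = 0" using rs(3) two[of s k] two[of r k] by auto
        with rs show ?thesis by (intro exI[of _ s] exI[of _ r] conjI)
      qed
    qed
    show ?thesis by (intro exI[of _ q] conjI) (use q(1) sw in auto)
  qed
  then have "\<exists>q. \<forall>m. (\<forall>k<n. q m k < Suc m) \<and> (\<forall>k<n. \<exists>r s. (\<forall>j<n. q m j \<le> r j \<and> r j \<le> q m j + 1) \<and>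
      (\<forall>j<n. q m j \<le> s j \<and> s j \<le> q m j + 1) \<and> lab (Suc m) r k = 0 \<and> lab (Suc m) s k = 1)"
    by (intro choice allI)
  then obtain q where q: "\<And>m k. k < n \<Longrightarrow> q m k < Suc m"
    and "\<forall>m. \<forall>k<n. \<exists>r s. (\<forall>j<n. q m j \<le> r j \<and> r j \<le> q m j + 1) \<and>
      (\<forall>j<n. q m j \<le> s j \<and> s j \<le> q m j + 1) \<and> lab (Suc m) r k = 0 \<and> lab (Suc m) s k = 1"
    by blast
  then have "\<forall>m k. \<exists>r s. k < n \<longrightarrow> (\<forall>j<n. q m j \<le> r j \<and> r j \<le> q m j + 1) \<and>
      (\<forall>j<n. q m j \<le> s j \<and> s j \<le> q m j + 1) \<and> lab (Suc m) r k = 0 \<and> lab (Suc m) s k = 1"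
    by blast
  then obtain r s where "\<forall>m k. k < n \<longrightarrow> (\<forall>j<n. q m j \<le> r m k j \<and> r m k j \<le> q m j + 1) \<and>
      (\<forall>j<n. q m j \<le> s m k j \<and> s m k j \<le> q m j + 1) \<and> lab (Suc m) (r m k) k = 0 \<and> lab (Suc m) (s m k) k = 1"
    unfolding choice_iff by blast
  then have rs: "\<And>m k j. k < n \<Longrightarrow> j < n \<Longrightarrow> q m j \<le> r m k j \<and> r m k j \<le> q m j + 1"
     "\<And>m k j. k < n \<Longrightarrow> j < n \<Longrightarrow> q m j \<le> s m k j \<and> s m k j \<le> q m j + 1"
     "\<And>m k. k < n \<Longrightarrow> lab (Suc m) (r m k) k = 0" "\<And>m k. k < n \<Longrightarrow> lab (Suc m) (s m k) k = 1"
    by auto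
  \<comment> \<open>Padding with 0 beyond \<open>n\<close> turns the corners into sequences indexed
    by all naturals, a countable type to which the compactness lemma applies.\<close>
  define qq where "qq m k = (if k < n then real (q m k) / Suc m else 0)" for m k
  have "qq m k \<in> {0..1}" for m k
    using q[of k m] by (auto simp: qq_def divide_le_eq)
  then obtain l \<sigma> where \<sigma>: "strict_mono (\<sigma> :: nat \<Rightarrow> nat)" "\<And>k. l k \<in> {0..1}"
    "\<And>k. (\<lambda>m. qq (\<sigma> m) k) \<longlonglongrightarrow> l k"
    by (rule bounded_pointwise_convergent_subseq[of qq]) auto
  have inv0: "(\<lambda>m. 1 / real (Suc (\<sigma> m))) \<longlonglongrightarrow> 0"
    using LIMSEQ_subseq_LIMSEQ[OF LIMSEQ_inverse_real_of_nat \<sigma>(1)]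
    by (simp add: o_def inverse_eq_divide)
  \<comment> \<open>The mesh tends to 0, so all vertices of the selected small cubes share the limit
    of the corners.\<close>
  have near: "(\<lambda>m. real (x (\<sigma> m) k) / Suc (\<sigma> m)) \<longlonglongrightarrow> l k"
    if "k < n" "\<And>m. q m k \<le> x m k \<and> x m k \<le> q m k + 1" for x :: "nat \<Rightarrow> nat \<Rightarrow> nat" and k
  proof (rule tendsto_sandwich[OF always_eventually always_eventually])
    show "(\<lambda>m. qq (\<sigma> m) k) \<longlonglongrightarrow> l k" by fact
    show "(\<lambda>m. qq (\<sigma> m) k + 1 / real (Suc (\<sigma> m))) \<longlonglongrightarrow> l k"
      using tendsto_add[OF \<sigma>(3) inv0, of k] by simp
    show "\<forall>m. qq (\<sigma> m) k \<le> real (x (\<sigma> m) k) / Suc (\<sigma> m)"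
      using that by (auto simp: qq_def intro!: divide_right_mono)
    show "\<forall>m. real (x (\<sigma> m) k) / Suc (\<sigma> m) \<le> qq (\<sigma> m) k + 1 / real (Suc (\<sigma> m))"
    proof
      fix m
      have "real (x (\<sigma> m) k) \<le> real (q (\<sigma> m) k) + 1" using that(2)[of "\<sigma> m"] by linarith
      then show "real (x (\<sigma> m) k) / Suc (\<sigma> m) \<le> qq (\<sigma> m) k + 1 / real (Suc (\<sigma> m))"
        using that(1) by (simp add: qq_def add_divide_distrib[symmetric] divide_right_mono)
    qed
  qed
  define z where "z i = l (d i)" for i
  have conv: "(\<lambda>m. f (pt (Suc (\<sigma> m)) (x (\<sigma> m))) i) \<longlonglongrightarrow> f z i"
    if x: "\<And>m j. j < n \<Longrightarrow> q m j \<le> x m j \<and> x m j \<le> q m j + 1" and "i \<in> I" for x i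
  proof (rule cont[OF _ _ _ \<open>i \<in> I\<close>])
    show "z j \<in> {0..1}" for j using \<sigma>(2) z_def by simp
    show "pt (Suc (\<sigma> m)) (x (\<sigma> m)) j \<in> {0..1}" if "j \<in> I" for m j
    proof (rule pt01[OF _ that])
      fix k assume "k < n"
      then show "x (\<sigma> m) k \<le> Suc (\<sigma> m)" using x[of k "\<sigma> m"] q[of k "\<sigma> m"] by linarith
    qed
    show "(\<lambda>m. pt (Suc (\<sigma> m)) (x (\<sigma> m)) j) \<longlonglongrightarrow> z j" if "j \<in> I" for j
      unfolding pt_def z_def by (rule near) (use d(1)[OF that] x in auto)
  qed
  have "f z i = z i" if i: "i \<in> I" for i
  proof -
    define k where "k = d i"
    have k: "k < n" "e k = i" using d i by (auto simp: k_def)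
    have le: "x m k' \<le> Suc m" if "\<And>m j. j < n \<Longrightarrow> q m j \<le> x m j \<and> x m j \<le> q m j + 1" "k' < n" for x m k'
      using that(1)[of k' m] q[of k' m] that(2) by linarith
    \<comment> \<open>The vertices labelled 0 and those labelled 1 both converge to
      \<open>z\<close>; their opposite inequalities survive in the limit and together give
      equality.\<close>
    have "z i \<le> f z i"
    proof (rule LIMSEQ_le)
      show "(\<lambda>m. real (r (\<sigma> m) k k) / Suc (\<sigma> m)) \<longlonglongrightarrow> z i"
        unfolding z_def k_def[symmetric] using near[of k "\<lambda>m. r m k"] rs(1)[of k] k by auto
      show "(\<lambda>m. f (pt (Suc (\<sigma> m)) (r (\<sigma> m) k)) i) \<longlonglongrightarrow> f z i"
        using conv[of "\<lambda>m. r m k"] rs(1)[of k] k i by auto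
      show "\<exists>N. \<forall>m\<ge>N. real (r (\<sigma> m) k k) / Suc (\<sigma> m) \<le> f (pt (Suc (\<sigma> m)) (r (\<sigma> m) k)) i"
        using lab0[OF rs(3)[OF k(1)] le[of "\<lambda>m. r m k"] k(1)] rs(1)[OF k(1)] k(2) by auto
    qed
    moreover have "f z i \<le> z i"
    proof (rule LIMSEQ_le)
      show "(\<lambda>m. real (s (\<sigma> m) k k) / Suc (\<sigma> m)) \<longlonglongrightarrow> z i"
        unfolding z_def k_def[symmetric] using near[of k "\<lambda>m. s m k"] rs(2)[of k] k by auto
      show "(\<lambda>m. f (pt (Suc (\<sigma> m)) (s (\<sigma> m) k)) i) \<longlonglongrightarrow> f z i"
        using conv[of "\<lambda>m. s m k"] rs(2)[of k] k i by auto
      show "\<exists>N. \<forall>m\<ge>N. f (pt (Suc (\<sigma> m)) (s (\<sigma> m) k)) i \<le> real (s (\<sigma> m) k k) / Suc (\<sigma> m)"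
        using lab1[OF rs(4)[OF k(1)] le[of "\<lambda>m. s m k"] k(1)] rs(2)[OF k(1)] k(2) by auto
    qed
    ultimately show ?thesis by simp
  qed
  then show thesis using that[of z] \<sigma>(2) by (auto simp: z_def)
qed

section \<open>Weak compactness on the unit interval\<close>

lemma integrable_mult_bounded:
  fixes k g :: "'a \<Rightarrow> real"
  assumes "k \<in> borel_measurable M" "\<And>x. x \<in> space M \<Longrightarrow> \<bar>k x\<bar> \<le> C" "integrable M g"
  shows "integrable M (\<lambda>x. k x * g x)"
proof (rule Bochner_Integration.integrable_bound[of M "\<lambda>x. C * g x"])
  have "norm (k x * g x) \<le> norm (C * g x)" if "x \<in> space M" for x
    using assms(2)[OF that] by (simp add: abs_mult mult_right_mono)
  then show "AE x in M. norm (k x * g x) \<le> norm (C * g x)" by auto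
qed (use assms in auto)

text \<open>Since the functions lie between 0 and 1, the integral over \<open>A i\<close> is
  dominated by the measure of \<open>A i\<close>, uniformly in \<open>n\<close>. These measures are
  summable, so Tannery's theorem allows the limit and the sum to be exchanged.\<close>

lemma set_integral_disjoint_UN_tendsto:
  fixes \<phi> :: "nat \<Rightarrow> 'a \<Rightarrow> real"
  assumes M: "finite_measure M"
    and meas: "\<And>n. \<phi> n \<in> borel_measurable M"
    and bd: "\<And>n x. x \<in> space M \<Longrightarrow> \<phi> n x \<in> {0..1}"
    and A: "disjoint_family A" "range A \<subseteq> sets M"
    and lim: "\<And>i. (\<lambda>n. \<integral>x. indicator (A i) x * \<phi> n x \<partial>M) \<longlonglongrightarrow> l i"
  shows "summable l" "(\<lambda>n. \<integral>x. indicator (\<Union>i. A i) x * \<phi> n x \<partial>M) \<longlonglongrightarrow> (\<Sum>i. l i)"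
proof -
  interpret finite_measure M by fact
  define m where "m n A = (\<integral>x. indicator A x * \<phi> n x \<partial>M)" for n A
  have int: "integrable M (\<lambda>x. indicator A x * \<phi> n x)" if "A \<in> sets M" for A n
    by (rule integrable_const_bound[of _ 1])
       (use bd meas that in \<open>auto simp: indicator_def\<close>)
  have m_bd: "0 \<le> m n A" "m n A \<le> measure M A" if "A \<in> sets M" for n A
  proof -
    show "0 \<le> m n A" unfolding m_def by (rule integral_nonneg_AE) (use bd in \<open>auto simp: indicator_def\<close>)
    have "m n A \<le> (\<integral>x. indicator A x \<partial>M)" unfolding m_def
      by (rule integral_mono)
        (use bd int that in \<open>auto simp: indicator_def intro!: integrable_const_bound[of _ 1]\<close>)
    then show "m n A \<le> measure M A" using that by simp
  qed
  have Asets: "A i \<in> sets M" for i using A by auto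
  have sums: "m n (\<Union>i. A i) = (\<Sum>i. m n (A i))" for n
  proof -
    have "set_integrable M (\<Union>i. A i) (\<phi> n)"
      unfolding set_integrable_def using int[of "\<Union>i. A i" n] Asets by auto
    then show ?thesis
      using lebesgue_integral_countable_add[of A M "\<phi> n"] Asets A(1)
      by (simp add: m_def set_lebesgue_integral_def disjoint_family_on_def)
  qed
  have sM: "summable (\<lambda>i. measure M (A i))"
    using finite_measure_UNION[OF A(2,1)] by (rule sums_summable)
  have "eventually (\<lambda>n. summable (\<lambda>k. norm (m n (A k)))) sequentially \<and>
           summable (\<lambda>i. norm (l i)) \<and> (\<lambda>n. suminf (\<lambda>k. m n (A k))) \<longlonglongrightarrow> suminf l"
    by (rule tannerys_theorem[OF _ _ sM])
       (use lim m_bd Asets in \<open>auto simp: m_def[symmetric] intro!: always_eventually\<close>)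
  then show "summable l" "(\<lambda>n. \<integral>x. indicator (\<Union>i. A i) x * \<phi> n x \<partial>M) \<longlonglongrightarrow> (\<Sum>i. l i)"
    by (auto simp: m_def[symmetric] sums intro: summable_norm_cancel)
qed

text \<open>The limit set function is countably additive by
  \<open>set_integral_disjoint_UN_tendsto\<close> and vanishes on null sets because every integral
  does. It is therefore an absolutely continuous measure, and Radon-Nikodym provides the
  density.\<close>

lemma setwise_limit_density:
  fixes \<phi> :: "nat \<Rightarrow> 'a \<Rightarrow> real"
  assumes M: "finite_measure M"
    and meas: "\<And>n. \<phi> n \<in> borel_measurable M"
    and bd: "\<And>n x. x \<in> space M \<Longrightarrow> \<phi> n x \<in> {0..1}"
    and conv: "\<And>A. A \<in> sets M \<Longrightarrow> convergent (\<lambda>n. \<integral>x. indicator A x * \<phi> n x \<partial>M)"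
  obtains \<rho> where "integrable M \<rho>" "\<And>x. 0 \<le> \<rho> x"
    "\<And>A. A \<in> sets M \<Longrightarrow>
      (\<lambda>n. \<integral>x. indicator A x * \<phi> n x \<partial>M) \<longlonglongrightarrow> (\<integral>x. indicator A x * \<rho> x \<partial>M)"
proof -
  interpret finite_measure M by fact
  define m where "m n A = (\<integral>x. indicator A x * \<phi> n x \<partial>M)" for n A
  define L where "L A = lim (\<lambda>n. m n A)" for A
  have L: "(\<lambda>n. m n A) \<longlonglongrightarrow> L A" if "A \<in> sets M" for A
    using conv[OF that] by (simp add: m_def L_def convergent_LIMSEQ_iff)
  have m_nn: "0 \<le> m n A" for n A
    unfolding m_def by (rule integral_nonneg_AE) (use bd in \<open>auto simp: indicator_def\<close>)
  have L_nn: "0 \<le> L A" if "A \<in> sets M" for A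
    using L[OF that] m_nn by (intro LIMSEQ_le_const) auto
  define N where "N = measure_of (space M) (sets M) (\<lambda>A. ennreal (L A))"
  have N: "emeasure N A = ennreal (L A)" if "A \<in> sets M" for A
  proof (rule emeasure_measure_of[OF N_def])
    show "sets M \<subseteq> Pow (space M)" by (rule sets.space_closed)
    show "A \<in> sets N" using that by (simp add: N_def)
    show "positive (sets N) (\<lambda>A. ennreal (L A))"
      by (auto simp: positive_def L_def m_def)
    show "countably_additive (sets N) (\<lambda>A. ennreal (L A))"
    proof (rule countably_additiveI)
      fix F :: "nat \<Rightarrow> 'a set"
      assume F: "range F \<subseteq> sets N" "disjoint_family F" "(\<Union>i. F i) \<in> sets N"
      then have F': "range F \<subseteq> sets M" "F i \<in> sets M" "(\<Union>i. F i) \<in> sets M" for i by (auto simp: N_def)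
      note lims = set_integral_disjoint_UN_tendsto[OF M meas bd F(2) F'(1) L[unfolded m_def, OF F'(2)]]
      have "L (\<Union>i. F i) = (\<Sum>i. L (F i))"
        by (rule LIMSEQ_unique[OF L[OF F'(3)]]) (unfold m_def, rule lims(2))
      then show "(\<Sum>i. ennreal (L (F i))) = ennreal (L (\<Union>i. F i))"
        using lims(1) L_nn F'(2) by (simp add: suminf_ennreal2)
    qed
  qed
  have sets_N[simp]: "sets N = sets M" "space N = space M" by (auto simp: N_def)
  have "absolutely_continuous M N"
    unfolding absolutely_continuous_def
  proof
    fix A assume A: "A \<in> null_sets M"
    then have As: "A \<in> sets M" by auto
    have "m n A = 0" for n
      unfolding m_def
    proof (rule integral_eq_zero_AE)
      show "AE x in M. indicator A x * \<phi> n x = 0" using AE_not_in[OF A] by eventually_elim auto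
    qed
    then have "L A = 0" using L[OF As] LIMSEQ_unique[OF tendsto_const] by fastforce
    then show "A \<in> null_sets N" using As N by (auto simp: null_sets_def)
  qed
  then obtain f where f: "f \<in> borel_measurable M" "density M f = N"
    using Radon_Nikodym[OF _ sets_N(1)] by auto
  have f_int: "(\<integral>\<^sup>+x. f x * indicator A x \<partial>M) = ennreal (L A)" if "A \<in> sets M" for A
    using N[OF that] emeasure_density[OF f(1) that] f(2) by simp
  have "(\<integral>\<^sup>+x. f x \<partial>M) = (\<integral>\<^sup>+x. f x * indicator (space M) x \<partial>M)"
    by (rule nn_integral_cong) simp
  then have "(\<integral>\<^sup>+x. f x \<partial>M) \<noteq> \<infinity>"
    using f_int[OF sets.top] by simp
  then have fin: "AE x in M. f x \<noteq> \<infinity>"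
    by (rule nn_integral_PInf_AE[OF f(1)])
  \<comment> \<open>The density has finite total mass, hence is finite almost everywhere, so the
    real-valued version differs from it only on a null set and is nonnegative everywhere.\<close>
  define \<rho> where "\<rho> x = enn2real (f x)" for x
  have \<rho>_nn: "0 \<le> \<rho> x" for x by (simp add: \<rho>_def)
  have \<rho>m[measurable]: "\<rho> \<in> borel_measurable M" using f(1) unfolding \<rho>_def by measurable
  have nn: "(\<integral>\<^sup>+x. ennreal (indicator A x * \<rho> x) \<partial>M) = ennreal (L A)" if "A \<in> sets M" for A
  proof -
    have "(\<integral>\<^sup>+x. ennreal (indicator A x * \<rho> x) \<partial>M) = (\<integral>\<^sup>+x. f x * indicator A x \<partial>M)"
      by (rule nn_integral_cong_AE, use fin in eventually_elim)
         (auto simp: \<rho>_def indicator_def less_top)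
    then show ?thesis using f_int[OF that] by simp
  qed
  have "integrable M (\<lambda>x. indicator (space M) x * \<rho> x)"
    by (rule integrableI_nonneg) (use nn[OF sets.top] in \<open>auto simp: \<rho>_nn\<close>)
  then have "integrable M \<rho>"
    by (rule Bochner_Integration.integrable_cong[THEN iffD1, rotated -1]) auto
  moreover have "(\<integral>x. indicator A x * \<rho> x \<partial>M) = L A" if "A \<in> sets M" for A
    using nn[OF that] L_nn[OF that] that by (subst integral_eq_nn_integral) (auto simp: \<rho>_nn)
  ultimately show thesis
    using that[of \<rho>] L by (auto simp: \<rho>_def m_def)
qed

text \<open>A bounded test function is the uniform limit of the step functions floor(K h) / K, for
  which the claim reduces to finitely many set integrals. The uniform error is harmless because the
  masses of all \<open>\<phi> n\<close> and of \<open>\<rho>\<close> have a common bound.\<close>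

lemma setwise_imp_weak_tendsto:
  fixes \<phi> :: "nat \<Rightarrow> 'a \<Rightarrow> real"
  assumes M: "finite_measure M"
    and meas[measurable]: "\<And>n. \<phi> n \<in> borel_measurable M"
    and bd: "\<And>n x. x \<in> space M \<Longrightarrow> \<phi> n x \<in> {0..1}"
    and \<rho>: "integrable M \<rho>" "\<And>x. 0 \<le> \<rho> x"
    and conv: "\<And>A. A \<in> sets M \<Longrightarrow>
      (\<lambda>n. \<integral>x. indicator A x * \<phi> n x \<partial>M) \<longlonglongrightarrow> (\<integral>x. indicator A x * \<rho> x \<partial>M)"
    and h[measurable]: "h \<in> borel_measurable M" and h_bd: "\<And>x. x \<in> space M \<Longrightarrow> \<bar>h x\<bar> \<le> B"
  shows "(\<lambda>n. \<integral>x. h x * \<phi> n x \<partial>M) \<longlonglongrightarrow> (\<integral>x. h x * \<rho> x \<partial>M)"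
proof -
  interpret finite_measure M by fact
  have [measurable]: "\<rho> \<in> borel_measurable M" using \<rho> by auto
  \<comment> \<open>As \<open>h\<close> is bounded by \<open>B\<close>, this finite set of integers
    contains every value of floor(K h), so \<open>hs K\<close> is a finite combination of
    indicators.\<close>
  define J where "J K = {\<lfloor>- (real K * B)\<rfloor> .. \<lfloor>real K * B\<rfloor>}" for K
  define E where "E K j = {x \<in> space M. \<lfloor>real K * h x\<rfloor> = j}" for K j
  define hs where "hs K x = (\<Sum>j\<in>J K. (real_of_int j / real K) * indicator (E K j) x)" for K x
  have E[measurable]: "E K j \<in> sets M" for K j unfolding E_def by measurable
  have hs_eq: "hs K x = real_of_int \<lfloor>real K * h x\<rfloor> / real K" if "x \<in> space M" for K x
  proof -
    have "\<bar>real K * h x\<bar> \<le> real K * B" using h_bd[OF that] by (simp add: abs_mult mult_left_mono)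
    then have "- (real K * B) \<le> real K * h x" "real K * h x \<le> real K * B" by linarith+
    then have mem: "\<lfloor>real K * h x\<rfloor> \<in> J K" unfolding J_def by (auto intro: floor_mono)
    have "hs K x = (\<Sum>j\<in>J K. if j = \<lfloor>real K * h x\<rfloor> then real_of_int j / real K else 0)"
      unfolding hs_def by (rule sum.cong) (use that in \<open>auto simp: E_def indicator_def\<close>)
    also have "\<dots> = real_of_int \<lfloor>real K * h x\<rfloor> / real K"
      using mem by (simp add: J_def)
    finally show ?thesis .
  qed
  have hs_close: "\<bar>h x - hs K x\<bar> \<le> 1 / real K" if "x \<in> space M" "K > 0" for x K
  proof -
    have "\<bar>real K * h x - real_of_int \<lfloor>real K * h x\<rfloor>\<bar> \<le> 1" by linarith
    then have "\<bar>real K * h x - real_of_int \<lfloor>real K * h x\<rfloor>\<bar> / real K \<le> 1 / real K"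
      by (rule divide_right_mono) simp
    moreover have "\<bar>h x - hs K x\<bar> = \<bar>real K * h x - real_of_int \<lfloor>real K * h x\<rfloor>\<bar> / real K"
      using that by (simp add: hs_eq field_simps abs_divide flip: abs_divide)
    ultimately show ?thesis by simp
  qed
  have int_ind: "integrable M (\<lambda>x. indicator A x * g x)" if "A \<in> sets M" "integrable M g"
    for A and g :: "'a \<Rightarrow> real"
    using integrable_real_mult_indicator[OF that] by (simp add: mult.commute)
  have hs_bd: "\<bar>hs K x\<bar> \<le> (\<Sum>j\<in>J K. \<bar>real_of_int j / real K\<bar>)" for K x
    unfolding hs_def by (rule order_trans[OF sum_abs sum_mono]) (auto simp: indicator_def)
  have hsm[measurable]: "hs K \<in> borel_measurable M" for K unfolding hs_def by measurable
  have \<phi>_int: "integrable M (\<phi> n)" for n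
    by (rule integrable_const_bound[of _ 1]) (use bd in auto)
  have hs_int: "(\<integral>x. hs K x * g x \<partial>M) =
      (\<Sum>j\<in>J K. (real_of_int j / real K) * (\<integral>x. indicator (E K j) x * g x \<partial>M))"
    if "integrable M g" for g K
  proof -
    have "(\<integral>x. hs K x * g x \<partial>M) = (\<integral>x. (\<Sum>j\<in>J K. (real_of_int j / real K) * (indicator (E K j) x * g x)) \<partial>M)"
      by (simp add: hs_def sum_distrib_right mult.assoc)
    also have "\<dots> = (\<Sum>j\<in>J K. (real_of_int j / real K) * (\<integral>x. indicator (E K j) x * g x \<partial>M))"
      using int_ind[OF E that] by (subst Bochner_Integration.integral_sum) auto
    finally show ?thesis .
  qed
  have close: "\<bar>(\<integral>x. h x * g x \<partial>M) - (\<integral>x. hs K x * g x \<partial>M)\<bar> \<le> (\<integral>x. g x \<partial>M) / real K"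
    if g: "integrable M g" "\<And>x. x \<in> space M \<Longrightarrow> 0 \<le> g x" and K: "K > 0" for g K
  proof -
    have i1: "integrable M (\<lambda>x. h x * g x)" by (rule integrable_mult_bounded[OF h h_bd g(1)])
    have i2: "integrable M (\<lambda>x. hs K x * g x)" by (rule integrable_mult_bounded[OF hsm hs_bd g(1)])
    have "\<bar>(\<integral>x. h x * g x \<partial>M) - (\<integral>x. hs K x * g x \<partial>M)\<bar> = \<bar>\<integral>x. h x * g x - hs K x * g x \<partial>M\<bar>"
      using i1 i2 by simp
    also have "\<dots> \<le> (\<integral>x. \<bar>h x * g x - hs K x * g x\<bar> \<partial>M)"
      by (rule integral_abs_bound)
    also have "\<dots> \<le> (\<integral>x. g x / real K \<partial>M)"
    proof (rule integral_mono)
      show "integrable M (\<lambda>x. \<bar>h x * g x - hs K x * g x\<bar>)" using i1 i2 by auto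
      show "integrable M (\<lambda>x. g x / real K)" using g by auto
      fix x assume x: "x \<in> space M"
      have "\<bar>h x * g x - hs K x * g x\<bar> = \<bar>h x - hs K x\<bar> * g x"
        using g(2)[OF x] by (simp add: left_diff_distrib[symmetric] abs_mult)
      also have "\<dots> \<le> 1 / real K * g x" using hs_close[OF x K] g(2)[OF x] by (rule mult_right_mono)
      finally show "\<bar>h x * g x - hs K x * g x\<bar> \<le> g x / real K" by simp
    qed
    finally show ?thesis by simp
  qed
  show ?thesis
  proof (rule LIMSEQ_I)
    fix e :: real assume e: "0 < e"
    \<comment> \<open>A common bound for the masses of \<open>\<phi> n\<close> and
      \<open>\<rho>\<close>; the added 1 makes it strictly positive, which forces
      \<open>K > 0\<close> below.\<close>
    define c where "c = measure M (space M) + (\<integral>x. \<rho> x \<partial>M) + 1"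
    have \<rho>nn: "0 \<le> (\<integral>x. \<rho> x \<partial>M)" using \<rho>(2) by simp
    have c: "0 < c" "measure M (space M) \<le> c" "(\<integral>x. \<rho> x \<partial>M) \<le> c"
      unfolding c_def using \<rho>nn by (auto simp: add_nonneg_pos)
    obtain K :: nat where K0: "3 * c / e < real K" using reals_Archimedean2 by blast
    then have K: "K > 0" using c(1) e by (metis divide_pos_pos gr0I less_asym mult_pos_pos of_nat_0 zero_less_numeral)
    have cK: "c / real K < e / 3" using K0 K e by (simp add: field_simps)
    have "(\<lambda>n. \<integral>x. hs K x * \<phi> n x \<partial>M) \<longlonglongrightarrow> (\<integral>x. hs K x * \<rho> x \<partial>M)"
      unfolding hs_int[OF \<phi>_int] hs_int[OF \<rho>(1)] by (intro tendsto_intros conv E)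
    then obtain n0 where n0: "\<And>n. n \<ge> n0 \<Longrightarrow> \<bar>(\<integral>x. hs K x * \<phi> n x \<partial>M) - (\<integral>x. hs K x * \<rho> x \<partial>M)\<bar> < e / 3"
      using e LIMSEQ_D[of _ _ "e/3"] by force
    have "\<bar>(\<integral>x. h x * \<phi> n x \<partial>M) - (\<integral>x. h x * \<rho> x \<partial>M)\<bar> < e" if "n \<ge> n0" for n
    proof -
      have bd0: "0 \<le> \<phi> n x" if "x \<in> space M" for x using bd[OF that] by auto
      have "(\<integral>x. \<phi> n x \<partial>M) \<le> (\<integral>x. 1 \<partial>M)"
        by (rule integral_mono) (use \<phi>_int bd in auto)
      then have "(\<integral>x. \<phi> n x \<partial>M) / real K \<le> c / real K"
        using c(2) by (intro divide_right_mono) auto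
      then have 1: "\<bar>(\<integral>x. h x * \<phi> n x \<partial>M) - (\<integral>x. hs K x * \<phi> n x \<partial>M)\<bar> < e / 3"
        using close[OF \<phi>_int[of n] bd0 K] cK by linarith
      have "(\<integral>x. \<rho> x \<partial>M) / real K \<le> c / real K"
        using c(3) by (intro divide_right_mono) auto
      then have 2: "\<bar>(\<integral>x. h x * \<rho> x \<partial>M) - (\<integral>x. hs K x * \<rho> x \<partial>M)\<bar> < e / 3"
        using close[OF \<rho>(1) \<rho>(2) K] cK by linarith
      show ?thesis using 1 2 n0[OF that] by linarith
    qed
    then show "\<exists>no. \<forall>n\<ge>no. norm ((\<integral>x. h x * \<phi> n x \<partial>M) - (\<integral>x. h x * \<rho> x \<partial>M)) < e"
      by auto
  qed
qed

lemma convergent_unif_approx: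
  fixes a :: "nat \<Rightarrow> real"
  assumes "\<And>e. e > 0 \<Longrightarrow> \<exists>b. convergent b \<and> (\<forall>n. \<bar>a n - b n\<bar> \<le> e)"
  shows "convergent a"
proof -
  have "Cauchy a"
  proof (rule metric_CauchyI)
    fix e :: real assume e: "e > 0"
    then obtain b where b: "convergent b" "\<And>n. \<bar>a n - b n\<bar> \<le> e / 4"
      using assms[of "e / 4"] by auto
    obtain N where N: "\<And>m n. m \<ge> N \<Longrightarrow> n \<ge> N \<Longrightarrow> dist (b m) (b n) < e / 4"
      using metric_CauchyD[OF convergent_Cauchy[OF b(1)], of "e / 4"] e by auto
    have "dist (a m) (a n) < e" if "m \<ge> N" "n \<ge> N" for m n
      using b(2)[of m] b(2)[of n] N[OF that] e unfolding dist_real_def by linarith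
    then show "\<exists>N. \<forall>m\<ge>N. \<forall>n\<ge>N. dist (a m) (a n) < e" by blast
  qed
  then show ?thesis by (simp add: Cauchy_convergent_iff)
qed

abbreviation unit_lborel :: "real measure" where
  "unit_lborel \<equiv> restrict_space lborel {0..1}"

lemma unit_lborel_finite_measure: "finite_measure unit_lborel" "measure unit_lborel {0..1} = 1"
proof -
  show "finite_measure unit_lborel"
    by (rule finite_measureI) (simp add: emeasure_restrict_space)
  show "measure unit_lborel {0..1} = 1"
    by (simp add: measure_restrict_space)
qed

text \<open>Sequential weak-star compactness for functions with values in [0,1]. The pairs of a
  rational endpoint and an index \<open>k\<close> form a countable type, so a single subsequence
  serves all \<open>k\<close> at once; the stages are then convergence on rays, on Borel sets, and
  against bounded test functions.\<close>

theorem weak_compactness_unit_interval: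
  fixes \<phi> :: "nat \<Rightarrow> 'k::countable \<Rightarrow> real \<Rightarrow> real"
  assumes meas[measurable]: "\<And>n k. \<phi> n k \<in> borel_measurable unit_lborel"
    and bd: "\<And>n k x. x \<in> {0..1} \<Longrightarrow> \<phi> n k x \<in> {0..1}"
  obtains \<sigma> \<rho> where "strict_mono (\<sigma> :: nat \<Rightarrow> nat)"
    "\<And>k. integrable unit_lborel (\<rho> k)" "\<And>k x. 0 \<le> \<rho> k x"
    "\<And>k h B. h \<in> borel_measurable unit_lborel \<Longrightarrow> (\<And>x. x \<in> {0..1} \<Longrightarrow> \<bar>h x\<bar> \<le> B) \<Longrightarrow>
      (\<lambda>n. \<integral>x. h x * \<phi> (\<sigma> n) k x \<partial>unit_lborel) \<longlonglongrightarrow> (\<integral>x. h x * \<rho> k x \<partial>unit_lborel)"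
proof -
  interpret finite_measure unit_lborel by (rule unit_lborel_finite_measure)
  have bd': "\<phi> n k x \<in> {0..1}" if "x \<in> space unit_lborel" for n k x
    using bd that by simp
  have sets_unit: "A \<inter> {0..1} \<in> sets unit_lborel" if "A \<in> sets borel" for A
    using that by (auto simp: sets_restrict_space)
  define m where "m n k A = (\<integral>x. indicator A x * \<phi> n k x \<partial>unit_lborel)" for n k A
  \<comment> \<open>The measure lives on the unit interval, so a set and its trace there have the
    same integral. Dynkin's lemma can thus be run in the Borel sets of the whole line.\<close>
  have m_Int: "m n k (A \<inter> {0..1}) = m n k A" for n k A
    unfolding m_def by (rule Bochner_Integration.integral_cong) (auto simp: indicator_def)
  have ind_meas: "(indicator A :: real \<Rightarrow> real) \<in> borel_measurable unit_lborel" if "A \<in> sets borel" for A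
    using that by (intro measurable_restrict_space1) auto
  have int: "integrable unit_lborel (\<lambda>x. indicator A x * \<phi> n k x)" if "A \<in> sets borel" for A n k
  proof (rule integrable_const_bound[of _ 1])
    show "AE x in unit_lborel. norm (indicator A x * \<phi> n k x) \<le> 1"
      using bd by (auto simp: indicator_def)
    show "(\<lambda>x. indicator A x * \<phi> n k x) \<in> borel_measurable unit_lborel"
      using ind_meas[OF that] by measurable
  qed
  have m_nn: "0 \<le> m n k A" for n k A
    unfolding m_def by (rule integral_nonneg_AE) (use bd in \<open>auto simp: indicator_def\<close>)
  have m_le: "m n k A \<le> measure unit_lborel (A \<inter> {0..1})" if "A \<in> sets borel" for n k A
  proof -
    have "m n k A \<le> (\<integral>x. indicator (A \<inter> {0..1}) x \<partial>unit_lborel)" unfolding m_def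
    proof (rule integral_mono[OF int[OF that]])
      show "integrable unit_lborel (indicator (A \<inter> {0..1}) :: real \<Rightarrow> real)"
        by (rule integrable_const_bound[of _ 1])
          (use sets_unit[OF that] in \<open>auto simp: indicator_def\<close>)
    qed (use bd in \<open>auto simp: indicator_def\<close>)
    then show ?thesis using sets_unit[OF that] by simp
  qed
  have m_le1: "m n k A \<le> 1" if "A \<in> sets borel" for n k A
    using order_trans[OF m_le[OF that] bounded_measure] unit_lborel_finite_measure(2) by simp
  have m_add: "m n k (A \<union> B) = m n k A + m n k B" if "A \<in> sets borel" "B \<in> sets borel" "A \<inter> B = {}" for n k A B
  proof -
    have "m n k (A \<union> B) = (\<integral>x. indicator A x * \<phi> n k x + indicator B x * \<phi> n k x \<partial>unit_lborel)"
      unfolding m_def by (rule Bochner_Integration.integral_cong) (use that in \<open>auto simp: indicator_def\<close>)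
    also have "\<dots> = m n k A + m n k B"
      unfolding m_def using int that by (intro Bochner_Integration.integral_add) auto
    finally show ?thesis .
  qed
  \<comment> \<open>Convergence on the rays with rational endpoint, extended to all Borel sets by Dynkin's lemma.\<close>
  obtain \<sigma> l where \<sigma>: "strict_mono (\<sigma> :: nat \<Rightarrow> nat)"
    and l: "\<And>qk. (\<lambda>n. m (\<sigma> n) (snd qk) {..real_of_rat (fst qk)}) \<longlonglongrightarrow> l qk"
    by (rule bounded_pointwise_convergent_subseq[of "\<lambda>n (qk :: rat \<times> 'k). m n (snd qk) {..real_of_rat (fst qk)}"])
      (use m_nn m_le1 in auto)
  have conv: "convergent (\<lambda>n. m (\<sigma> n) k A)" if "A \<in> sets borel" for A k
  proof -
    have *: "sets (borel :: real measure) = sigma_sets UNIV (range (\<lambda>a. {..a}))"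
      by (subst borel_eq_atMost) auto
    have "Int_stable (range (\<lambda>a::real. {..a}))"
      by (auto simp: Int_stable_def)
    from this subset_UNIV[of "range (\<lambda>a::real. {..a})", folded Pow_UNIV] that[unfolded *]
    show ?thesis
    proof (induction rule: sigma_sets_induct_disjoint)
      case (basic A)
      then obtain s where s: "A = {..s}" by auto
      show ?case
      proof (rule convergent_unif_approx)
        fix e :: real assume "e > 0"
        \<comment> \<open>Moving the endpoint up to a nearby rational adds an interval of length
          below \<open>e\<close>. As the functions are at most 1, the integrals change by at most
          \<open>e\<close>, uniformly in \<open>n\<close>.\<close>
        then obtain q where q: "s < real_of_rat q" "real_of_rat q < s + e"
          using of_rat_dense[of s "s + e"] by auto
        have "\<bar>m n k A - m n k {..real_of_rat q}\<bar> \<le> e" for n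
        proof -
          have "{..real_of_rat q} = A \<union> {s<..real_of_rat q}" using q s by auto
          then have "m n k {..real_of_rat q} = m n k A + m n k {s<..real_of_rat q}"
            using m_add[of "{..s}" "{s<..real_of_rat q}" n k] s by (simp add: ivl_disj_int)
          moreover have "measure unit_lborel ({s<..real_of_rat q} \<inter> {0..1}) \<le> measure lborel {s<..real_of_rat q}"
          proof -
            have "measure lborel ({s<..real_of_rat q} \<inter> {0..1}) \<le> measure lborel {s<..real_of_rat q}"
              by (rule measure_mono_fmeasurable) (use q in \<open>auto simp: fmeasurable_def\<close>)
            then show ?thesis by (subst measure_restrict_space) auto
          qed
          then have "m n k {s<..real_of_rat q} \<le> real_of_rat q - s"
            using m_le[of "{s<..real_of_rat q}" n k] q by simp
          ultimately show ?thesis using m_nn[of n k "{s<..real_of_rat q}"] q by linarith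
        qed
        moreover have "convergent (\<lambda>n. m (\<sigma> n) k {..real_of_rat q})"
          using l[of "(q, k)"] by (auto simp: convergent_def)
        ultimately show "\<exists>b. convergent b \<and> (\<forall>n. \<bar>m (\<sigma> n) k A - b n\<bar> \<le> e)" by blast
      qed
    next
      case empty
      then show ?case by (simp add: m_def convergent_const)
    next
      case (compl A)
      have A: "A \<in> sets borel" using compl * by simp
      have "m n k (UNIV - A) = m n k UNIV - m n k A" for n
        using m_add[of A "UNIV - A" n k] A by (auto simp: Un_Diff_cancel)
      moreover have "convergent (\<lambda>n. m (\<sigma> n) k UNIV)"
      proof -
        \<comment> \<open>The ray ending at 1 already covers the unit interval, which gives
          convergence of the total mass needed for complements.\<close>
        have "m n k {..real_of_rat 1} = m n k UNIV" for n
          unfolding m_def by (rule Bochner_Integration.integral_cong) (auto simp: indicator_def)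
        then show ?thesis using l[of "(1, k)"] by (auto simp: convergent_def)
      qed
      ultimately show ?case using compl by (simp add: convergent_diff)
    next
      case (union A)
      have A: "A i \<in> sets borel" for i using union * by auto
      obtain L where L: "\<And>i. (\<lambda>n. m (\<sigma> n) k (A i)) \<longlonglongrightarrow> L i"
        using union(3) unfolding convergent_def by metis
      have "(\<lambda>n. m (\<sigma> n) k (\<Union>i. A i \<inter> {0..1})) \<longlonglongrightarrow> (\<Sum>i. L i)"
        unfolding m_def
      proof (rule set_integral_disjoint_UN_tendsto(2)[OF unit_lborel_finite_measure(1), where \<phi> = "\<lambda>n. \<phi> (\<sigma> n) k", OF meas bd'])
        show "disjoint_family (\<lambda>i. A i \<inter> {0..1})" using union(1) by (auto simp: disjoint_family_on_def)
        show "range (\<lambda>i. A i \<inter> {0..1}) \<subseteq> sets unit_lborel" using A sets_unit by auto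
        show "(\<lambda>n. \<integral>x. indicator (A i \<inter> {0..1}) x * \<phi> (\<sigma> n) k x \<partial>unit_lborel) \<longlonglongrightarrow> L i" for i
          using L[of i] m_Int[of _ k "A i"] by (simp add: m_def)
      qed
      moreover have "(\<Union>i. A i \<inter> {0..1}) = (\<Union>i. A i) \<inter> {0..1}" by auto
      ultimately show ?case using m_Int[of _ k "\<Union>i. A i"] by (auto simp: convergent_def)
    qed
  qed
  have "\<exists>\<rho>. integrable unit_lborel \<rho> \<and> (\<forall>x. 0 \<le> \<rho> x) \<and> (\<forall>A \<in> sets unit_lborel.
      (\<lambda>n. \<integral>x. indicator A x * \<phi> (\<sigma> n) k x \<partial>unit_lborel) \<longlonglongrightarrow> (\<integral>x. indicator A x * \<rho> x \<partial>unit_lborel))" for k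
  proof (rule setwise_limit_density[OF unit_lborel_finite_measure(1), where \<phi> = "\<lambda>n. \<phi> (\<sigma> n) k", OF meas bd'])
    fix A assume "A \<in> sets unit_lborel"
    then obtain B where "B \<in> sets borel" "A = {0..1} \<inter> B" by (auto simp: sets_restrict_space)
    then show "convergent (\<lambda>n. \<integral>x. indicator A x * \<phi> (\<sigma> n) k x \<partial>unit_lborel)"
      using conv[of B k] m_Int[of _ k B] by (simp add: m_def Int_commute)
  next
    fix \<rho> assume "integrable unit_lborel \<rho>" "\<And>x. 0 \<le> \<rho> x" "\<And>A. A \<in> sets unit_lborel \<Longrightarrow>
      (\<lambda>n. \<integral>x. indicator A x * \<phi> (\<sigma> n) k x \<partial>unit_lborel) \<longlonglongrightarrow> (\<integral>x. indicator A x * \<rho> x \<partial>unit_lborel)"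
    then show ?thesis by (intro exI[of _ \<rho>] conjI allI ballI)
  qed
  then have "\<exists>\<rho>. \<forall>k. integrable unit_lborel (\<rho> k) \<and> (\<forall>x. 0 \<le> \<rho> k x) \<and> (\<forall>A \<in> sets unit_lborel.
      (\<lambda>n. \<integral>x. indicator A x * \<phi> (\<sigma> n) k x \<partial>unit_lborel) \<longlonglongrightarrow> (\<integral>x. indicator A x * \<rho> k x \<partial>unit_lborel))"
    by (intro choice allI)
  then obtain \<rho> where "\<forall>k. integrable unit_lborel (\<rho> k) \<and> (\<forall>x. 0 \<le> \<rho> k x) \<and> (\<forall>A \<in> sets unit_lborel.
      (\<lambda>n. \<integral>x. indicator A x * \<phi> (\<sigma> n) k x \<partial>unit_lborel) \<longlonglongrightarrow> (\<integral>x. indicator A x * \<rho> k x \<partial>unit_lborel))"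
    by (elim exE)
  then have \<rho>: "\<And>k. integrable unit_lborel (\<rho> k)" "\<And>k x. 0 \<le> \<rho> k x"
    "\<And>k A. A \<in> sets unit_lborel \<Longrightarrow>
      (\<lambda>n. \<integral>x. indicator A x * \<phi> (\<sigma> n) k x \<partial>unit_lborel) \<longlonglongrightarrow> (\<integral>x. indicator A x * \<rho> k x \<partial>unit_lborel)"
    by auto
  show thesis
  proof (rule that[OF \<sigma> \<rho>(1,2)])
    fix k and h :: "real \<Rightarrow> real" and B :: real
    assume h: "h \<in> borel_measurable unit_lborel" "\<And>x. x \<in> {0..1} \<Longrightarrow> \<bar>h x\<bar> \<le> B"
    show "(\<lambda>n. \<integral>x. h x * \<phi> (\<sigma> n) k x \<partial>unit_lborel) \<longlonglongrightarrow> (\<integral>x. h x * \<rho> k x \<partial>unit_lborel)"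
      by (rule setwise_imp_weak_tendsto[where B = B, OF unit_lborel_finite_measure(1) meas bd' \<rho>(1)[of k] \<rho>(2)[of k]])
        (use \<rho>(3) h in simp_all)
  qed
qed

section \<open>Dynamic programming against a fixed neighbourhood flow\<close>

lemma tendsto_MAX:
  fixes f :: "'i \<Rightarrow> 'a \<Rightarrow> real"
  assumes "finite I" "I \<noteq> {}" "\<And>i. i \<in> I \<Longrightarrow> (f i \<longlongrightarrow> l i) F"
  shows "((\<lambda>n. MAX i\<in>I. f i n) \<longlongrightarrow> (MAX i\<in>I. l i)) F"
  using assms
proof (induction rule: finite_ne_induct)
  case (singleton i)
  then show ?case by simp
next
  case (insert i I)
  then show ?case by (simp add: tendsto_max)
qed

lemma abs_le_l1_norm: "\<bar>v a\<bar> \<le> l1_norm v"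
  unfolding l1_norm_def by (rule member_le_sum) auto

lemma prob_vec_le_1: "prob_vec v \<Longrightarrow> v a \<le> 1"
  unfolding prob_vec_def by (metis UNIV_I finite_class.finite_UNIV member_le_sum)

locale graphon_game =
  fixes P :: "'x::finite \<Rightarrow> 'u::finite \<Rightarrow> ('x \<Rightarrow> real) \<Rightarrow> ('x \<Rightarrow> real)"
    and r :: "'x \<Rightarrow> 'u \<Rightarrow> ('x \<Rightarrow> real) \<Rightarrow> real"
    and mu0 :: "'x \<Rightarrow> real"
    and W :: "real \<Rightarrow> real \<Rightarrow> real"
    and T :: nat
    and L_r L_P L_W :: real
  assumes mu0: "prob_vec mu0"
    and P: "\<And>x u g. bmeas_vec g \<Longrightarrow> prob_vec (P x u g)"
    and W: "graphon W"
    and r_lip: "reward_lipschitz L_r r"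
    and P_lip: "kernel_lipschitz L_P P"
    and W_lip: "L_W-lipschitz_on ({0..1} \<times> {0..1}) (\<lambda>p. W (fst p) (snd p))"
begin

text \<open>
  Throughout, \<open>h t\<close> is the neighbourhood mean field felt at time \<open>t\<close>, and \<open>val h k\<close> is the optimal
  value with \<open>k\<close> steps to go, that is, at time \<open>T - k\<close>.
\<close>

primrec val :: "(nat \<Rightarrow> 'x \<Rightarrow> real) \<Rightarrow> nat \<Rightarrow> 'x \<Rightarrow> real" where
  "val h 0 = (\<lambda>x. 0)"
| "val h (Suc k) = (\<lambda>x. MAX u. r x u (h (T - Suc k)) + (\<Sum>y\<in>UNIV. P x u (h (T - Suc k)) y * val h k y))"

definition Q :: "(nat \<Rightarrow> 'x \<Rightarrow> real) \<Rightarrow> nat \<Rightarrow> 'x \<Rightarrow> 'u \<Rightarrow> real" where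
  "Q h t x u = r x u (h t) + (\<Sum>y\<in>UNIV. P x u (h t) y * val h (T - Suc t) y)"

definition gap :: "(nat \<Rightarrow> 'x \<Rightarrow> real) \<Rightarrow> nat \<Rightarrow> 'x \<Rightarrow> 'u \<Rightarrow> real" where
  "gap h t x u = (MAX v. Q h t x v) - Q h t x u"

text \<open>The smoothed best response. The weights depend continuously on the gaps, and for
  positive \<epsilon> the denominator is at least \<epsilon> because some action has gap 0.\<close>

definition soft :: "real \<Rightarrow> (nat \<Rightarrow> 'x \<Rightarrow> real) \<Rightarrow> nat \<Rightarrow> 'x \<Rightarrow> 'u \<Rightarrow> real" where
  "soft \<epsilon> h t x u = max 0 (\<epsilon> - gap h t x u) / (\<Sum>v\<in>UNIV. max 0 (\<epsilon> - gap h t x v))"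

text \<open>Decoupling the forward recursion from the graphon lets one set of lemmas serve both the
  deviating agent (\<open>agent_law_eq\<close>) and the ensemble itself (\<open>psi_mf_eq\<close>):
  only the flow \<open>h\<close> differs.\<close>

primrec law :: "(nat \<Rightarrow> 'x \<Rightarrow> real) \<Rightarrow> (nat \<Rightarrow> 'x \<Rightarrow> 'u \<Rightarrow> real) \<Rightarrow> nat \<Rightarrow> 'x \<Rightarrow> real" where
  "law h pol 0 = mu0"
| "law h pol (Suc t) = (\<lambda>x. \<Sum>x'\<in>UNIV. law h pol t x' * (\<Sum>u\<in>UNIV. pol t x' u * P x' u (h t) x))"

text \<open>The joint state-action law under the smoothed policy. Unlike the state law and the
  policy taken separately, it enters the forward equation linearly, which is what weak limits
  preserve.\<close>

definition occ :: "real \<Rightarrow> (nat \<Rightarrow> 'x \<Rightarrow> real) \<Rightarrow> nat \<Rightarrow> 'x \<Rightarrow> 'u \<Rightarrow> real" where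
  "occ \<epsilon> h t x u = law h (soft \<epsilon> h) t x * soft \<epsilon> h t x u"

definition feasible :: "(nat \<Rightarrow> 'x \<Rightarrow> real) \<Rightarrow> bool" where
  "feasible h \<longleftrightarrow> (\<forall>t. bmeas_vec (h t))"

lemma val_Q:
  assumes "t < T" shows "val h (T - t) x = (MAX u. Q h t x u)"
proof -
  have "T - t = Suc (T - Suc t)" "T - Suc (T - Suc t) = t" using assms by auto
  then show ?thesis by (simp add: Q_def)
qed

lemma gap_nonneg: "0 \<le> gap h t x u"
  unfolding gap_def by simp

lemma gap_attained: "\<exists>u. gap h t x u = 0"
proof -
  have "(MAX v. Q h t x v) \<in> range (Q h t x)" by (rule Max_in) auto
  then obtain u where "(MAX v. Q h t x v) = Q h t x u" by (rule imageE)
  then show ?thesis by (intro exI[of _ u]) (simp add: gap_def)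
qed

lemma soft_prob:
  assumes "\<epsilon> > 0" shows "prob_vec (soft \<epsilon> h t x)"
proof -
  obtain u where u: "gap h t x u = 0" using gap_attained by blast
  have "\<epsilon> \<le> (\<Sum>v\<in>UNIV. max 0 (\<epsilon> - gap h t x v))"
    using member_le_sum[of u UNIV "\<lambda>v. max 0 (\<epsilon> - gap h t x v)"] u by auto
  then have "0 < (\<Sum>v\<in>UNIV. max 0 (\<epsilon> - gap h t x v))" using assms by linarith
  then show ?thesis
    unfolding prob_vec_def soft_def by (auto simp: sum_divide_distrib[symmetric] sum_nonneg)
qed

text \<open>Actions whose gap reaches \<epsilon> get no weight, and all others get weight at most
  1.\<close>

lemma soft_gap:
  assumes "\<epsilon> > 0" shows "soft \<epsilon> h t x u * gap h t x u \<le> \<epsilon>"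
proof (cases "gap h t x u < \<epsilon>")
  case True
  have "soft \<epsilon> h t x u * gap h t x u \<le> 1 * \<epsilon>"
    by (rule mult_mono) (use True gap_nonneg prob_vec_le_1[OF soft_prob[OF assms]] assms in auto)
  then show ?thesis by simp
next
  case False
  then have "soft \<epsilon> h t x u = 0" by (simp add: soft_def)
  then show ?thesis using assms by simp
qed

lemma law_prob:
  assumes "feasible h" "\<And>s x. s < t \<Longrightarrow> prob_vec (pol s x)"
  shows "prob_vec (law h pol t)"
  using assms(2)
proof (induction t)
  case 0
  then show ?case using mu0 by simp
next
  case (Suc t)
  then have IH: "prob_vec (law h pol t)" by simp
  have pol: "prob_vec (pol t x)" for x using Suc by simp
  have Ph: "prob_vec (P x u (h t))" for x u using P assms(1) by (simp add: feasible_def)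
  have "(\<Sum>x\<in>UNIV. law h pol (Suc t) x) =
      (\<Sum>x'\<in>UNIV. law h pol t x' * (\<Sum>u\<in>UNIV. pol t x' u * (\<Sum>x\<in>UNIV. P x' u (h t) x)))"
    unfolding law.simps sum_distrib_left
    by (subst sum.swap, intro sum.cong refl, subst sum.swap) simp
  also have "\<dots> = 1" using IH pol Ph by (simp add: prob_vec_def)
  finally have "(\<Sum>x\<in>UNIV. law h pol (Suc t) x) = 1" .
  moreover have "0 \<le> law h pol (Suc t) x" for x
    using IH pol Ph by (auto simp: prob_vec_def intro!: sum_nonneg mult_nonneg_nonneg)
  ultimately show ?case by (simp add: prob_vec_def)
qed

text \<open>By Bellman's equation the expected reward at time \<open>t\<close> is the drop in
  expected optimal value to go, minus the expected gap; summing over time telescopes. The first term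
  on the right does not depend on the policy, so a policy with zero gaps on its support is
  optimal.\<close>

lemma reward_decomposition:
  assumes "feasible h" and pol: "\<And>t x. t < T \<Longrightarrow> prob_vec (pol t x)"
  shows "(\<Sum>t<T. \<Sum>x\<in>UNIV. law h pol t x * (\<Sum>u\<in>UNIV. pol t x u * r x u (h t))) =
    (\<Sum>x\<in>UNIV. mu0 x * val h T x) - (\<Sum>t<T. \<Sum>x\<in>UNIV. law h pol t x * (\<Sum>u\<in>UNIV. pol t x u * gap h t x u))"
proof -
  define A where "A t = (\<Sum>x\<in>UNIV. law h pol t x * val h (T - t) x)" for t
  have step: "(\<Sum>x\<in>UNIV. law h pol t x * (\<Sum>u\<in>UNIV. pol t x u * r x u (h t))) =
    A t - A (Suc t) - (\<Sum>x\<in>UNIV. law h pol t x * (\<Sum>u\<in>UNIV. pol t x u * gap h t x u))" if t: "t < T" for t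
  proof -
    have "A (Suc t) = (\<Sum>x'\<in>UNIV. law h pol t x' *
        (\<Sum>u\<in>UNIV. pol t x' u * (\<Sum>x\<in>UNIV. P x' u (h t) x * val h (T - Suc t) x)))"
      unfolding A_def law.simps sum_distrib_left sum_distrib_right
      by (subst sum.swap, intro sum.cong refl, subst sum.swap) (simp add: mult_ac)
    then have "(\<Sum>x\<in>UNIV. law h pol t x * (\<Sum>u\<in>UNIV. pol t x u * r x u (h t))) + A (Suc t) =
       (\<Sum>x\<in>UNIV. law h pol t x * (\<Sum>u\<in>UNIV. pol t x u * Q h t x u))"
      by (simp add: Q_def sum.distrib distrib_left)
    moreover have "(\<Sum>u\<in>UNIV. pol t x u * Q h t x u) =
        val h (T - t) x - (\<Sum>u\<in>UNIV. pol t x u * gap h t x u)" for x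
    proof -
      have "(\<Sum>u\<in>UNIV. pol t x u * gap h t x u) =
          (\<Sum>u\<in>UNIV. pol t x u) * val h (T - t) x - (\<Sum>u\<in>UNIV. pol t x u * Q h t x u)"
        unfolding val_Q[OF t] gap_def by (simp add: right_diff_distrib sum_subtractf sum_distrib_right)
      then show ?thesis using pol[OF t, of x] by (simp add: prob_vec_def)
    qed
    ultimately show ?thesis
      by (simp add: A_def right_diff_distrib sum_subtractf)
  qed
  \<comment> \<open>\<open>A T\<close> vanishes since \<open>val h 0\<close> is zero: nothing is
    earned from the horizon on.\<close>
  have "(\<Sum>t<T. A t - A (Suc t)) = A 0 - A T"
    by (rule sum_lessThan_telescope')
  then show ?thesis using step by (simp add: sum_subtractf A_def)
qed

section \<open>Continuity of values, gaps and laws in the neighbourhood flow\<close>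

definition conv :: "(nat \<Rightarrow> nat \<Rightarrow> 'x \<Rightarrow> real) \<Rightarrow> (nat \<Rightarrow> 'x \<Rightarrow> real) \<Rightarrow> bool" where
  "conv hs h \<longleftrightarrow> (\<forall>n. feasible (hs n)) \<and> feasible h \<and> (\<forall>t x. (\<lambda>n. hs n t x) \<longlonglongrightarrow> h t x)"

lemma conv_l1: "conv hs h \<Longrightarrow> (\<lambda>n. l1_norm (\<lambda>y. hs n t y - h t y)) \<longlonglongrightarrow> 0"
  unfolding l1_norm_def conv_def
  by (intro tendsto_null_sum tendsto_rabs_zero LIM_zero) auto

text \<open>The Lipschitz bound at equal states and equal actions squeezes the difference to 0. It
  is assumed for nonnegative vectors only, which is why \<open>conv\<close> demands feasibility of
  the sequence and of its limit.\<close>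

lemma tendsto_P:
  assumes "conv hs h" shows "(\<lambda>n. P x u (hs n t) y) \<longlonglongrightarrow> P x u (h t) y"
proof (rule LIM_zero_cancel, rule tendsto_rabs_zero_cancel, rule tendsto_sandwich[of "\<lambda>_. 0"])
  show "(\<lambda>n. L_P * l1_norm (\<lambda>y. hs n t y - h t y)) \<longlonglongrightarrow> 0"
    using tendsto_mult_left[OF conv_l1[OF assms], of L_P] by simp
  have "\<bar>P x u (hs n t) y - P x u (h t) y\<bar> \<le> L_P * l1_norm (\<lambda>y. hs n t y - h t y)" for n
  proof -
    have "l1_norm (\<lambda>y. P x u (hs n t) y - P x u (h t) y) \<le> L_P * (ddist x x + ddist u u + l1_norm (\<lambda>y. hs n t y - h t y))"
      using P_lip assms unfolding kernel_lipschitz_def conv_def feasible_def by blast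
    then show ?thesis
      using abs_le_l1_norm[of "\<lambda>y. P x u (hs n t) y - P x u (h t) y" y] by (simp add: ddist_def)
  qed
  then show "\<forall>\<^sub>F n in sequentially. \<bar>P x u (hs n t) y - P x u (h t) y\<bar> \<le> L_P * l1_norm (\<lambda>y. hs n t y - h t y)"
    by simp
qed auto

lemma tendsto_r:
  assumes "conv hs h" shows "(\<lambda>n. r x u (hs n t)) \<longlonglongrightarrow> r x u (h t)"
proof (rule LIM_zero_cancel, rule tendsto_rabs_zero_cancel, rule tendsto_sandwich[of "\<lambda>_. 0"])
  show "(\<lambda>n. L_r * l1_norm (\<lambda>y. hs n t y - h t y)) \<longlonglongrightarrow> 0"
    using tendsto_mult_left[OF conv_l1[OF assms], of L_r] by simp
  have "\<bar>r x u (hs n t) - r x u (h t)\<bar> \<le> L_r * (ddist x x + ddist u u + l1_norm (\<lambda>y. hs n t y - h t y))" for n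
    using r_lip assms unfolding reward_lipschitz_def conv_def feasible_def by blast
  then show "\<forall>\<^sub>F n in sequentially. \<bar>r x u (hs n t) - r x u (h t)\<bar> \<le> L_r * l1_norm (\<lambda>y. hs n t y - h t y)"
    by (simp add: ddist_def)
qed auto

lemma tendsto_val: "conv hs h \<Longrightarrow> (\<lambda>n. val (hs n) k x) \<longlonglongrightarrow> val h k x"
proof (induction k arbitrary: x)
  case 0
  then show ?case by simp
next
  case (Suc k)
  then show ?case
    unfolding val.simps by (intro tendsto_MAX tendsto_intros tendsto_P tendsto_r) auto
qed

lemma tendsto_Q: "conv hs h \<Longrightarrow> (\<lambda>n. Q (hs n) t x u) \<longlonglongrightarrow> Q h t x u"
  unfolding Q_def by (intro tendsto_intros tendsto_P tendsto_r tendsto_val)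

lemma tendsto_gap: "conv hs h \<Longrightarrow> (\<lambda>n. gap (hs n) t x u) \<longlonglongrightarrow> gap h t x u"
  unfolding gap_def by (intro tendsto_intros tendsto_MAX tendsto_Q) auto

lemma tendsto_soft:
  assumes "conv hs h" "\<epsilon> > 0"
  shows "(\<lambda>n. soft \<epsilon> (hs n) t x u) \<longlonglongrightarrow> soft \<epsilon> h t x u"
proof -
  \<comment> \<open>Were the denominator 0, division by zero would make every weight 0,
    contradicting total mass 1.\<close>
  have "(\<Sum>v\<in>UNIV. max 0 (\<epsilon> - gap h t x v)) \<noteq> 0"
    using soft_prob[OF assms(2), of h t x] by (auto simp: soft_def prob_vec_def)
  then show ?thesis
    unfolding soft_def by (intro tendsto_intros tendsto_max tendsto_gap assms) auto
qed

lemma tendsto_law_soft: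
  assumes "conv hs h" "\<epsilon> > 0"
  shows "(\<lambda>n. law (hs n) (soft \<epsilon> (hs n)) t x) \<longlonglongrightarrow> law h (soft \<epsilon> h) t x"
proof (induction t arbitrary: x)
  case 0
  then show ?case by simp
next
  case (Suc t)
  then show ?case
    unfolding law.simps by (intro tendsto_intros tendsto_P tendsto_soft assms)
qed

lemma occ_flow: "(\<Sum>u\<in>UNIV. occ \<epsilon> h t x u) = law h (soft \<epsilon> h) t x" if "\<epsilon> > 0"
  using soft_prob[OF that] by (simp add: occ_def sum_distrib_left[symmetric] prob_vec_def)

lemma law_soft_Suc: "law h (soft \<epsilon> h) (Suc t) x = (\<Sum>x'\<in>UNIV. \<Sum>u\<in>UNIV. occ \<epsilon> h t x' u * P x' u (h t) x)"
  by (simp add: occ_def sum_distrib_left mult.assoc)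

lemma law_soft_range:
  assumes "feasible h" "\<epsilon> > 0" shows "law h (soft \<epsilon> h) t x \<in> {0..1}"
proof -
  have "prob_vec (law h (soft \<epsilon> h) t)" by (rule law_prob) (use soft_prob assms in auto)
  then show ?thesis using prob_vec_le_1[of "law h (soft \<epsilon> h) t" x] by (simp add: prob_vec_def)
qed

lemma occ_range:
  assumes "feasible h" "\<epsilon> > 0" shows "occ \<epsilon> h t x u \<in> {0..1}"
  using law_soft_range[OF assms, of t x] soft_prob[OF assms(2), of h t x] prob_vec_le_1[of "soft \<epsilon> h t x" u]
  by (auto simp: occ_def prob_vec_def intro!: mult_le_one)

lemma occ_gap:
  assumes "feasible h" "\<epsilon> > 0" shows "occ \<epsilon> h t x u * gap h t x u \<in> {0..\<epsilon>}"
proof -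
  have "law h (soft \<epsilon> h) t x * (soft \<epsilon> h t x u * gap h t x u) \<le> 1 * \<epsilon>"
    by (rule mult_mono) (use law_soft_range[OF assms, of t x] soft_gap assms(2) soft_prob[OF assms(2), of h t x] gap_nonneg in \<open>auto simp: prob_vec_def\<close>)
  moreover have "0 \<le> occ \<epsilon> h t x u * gap h t x u"
    using occ_range[OF assms, of t x u] gap_nonneg[of h t x u] by auto
  ultimately show ?thesis by (simp add: occ_def mult.assoc)
qed

end

section \<open>Approximate equilibria\<close>

lemma borel_measurable_unit_continuous:
  fixes f :: "real \<Rightarrow> real"
  assumes "continuous_on {0..1} f" shows "f \<in> borel_measurable unit_lborel"
proof -
  have "sets unit_lborel = sets (restrict_space borel {0..1})"
    by (rule sets_restrict_space_cong) simp
  then show ?thesis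
    using borel_measurable_continuous_on_restrict[OF assms] measurable_cong_sets by blast
qed

context graphon_game
begin

lemma W_bound: "\<exists>C>0. \<forall>a\<in>{0..1}. \<forall>b\<in>{0..1}. 0 \<le> W a b \<and> W a b \<le> C"
proof -
  have "compact ({0..1} \<times> {0..1} :: (real \<times> real) set)" by (intro compact_Times) auto
  then have "bounded ((\<lambda>p. W (fst p) (snd p)) ` ({0..1} \<times> {0..1}))"
    using compact_continuous_image[OF lipschitz_on_continuous_on[OF W_lip]] compact_imp_bounded by blast
  then obtain C where C: "C > 0" "\<forall>w \<in> (\<lambda>p. W (fst p) (snd p)) ` ({0..1} \<times> {0..1}). norm w \<le> C"
    unfolding bounded_pos by blast
  have "0 \<le> W a b \<and> W a b \<le> C" if "a \<in> {0..1}" "b \<in> {0..1}" for a b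
  proof -
    have "norm (W a b) \<le> C" using C(2) that by force
    moreover have "0 \<le> W a b" using W that by (simp add: graphon_def)
    ultimately show ?thesis by simp
  qed
  with C(1) show ?thesis by blast
qed

lemma W_diff: "\<bar>W a b - W a' b\<bar> \<le> L_W * \<bar>a - a'\<bar>" if "a \<in> {0..1}" "a' \<in> {0..1}" "b \<in> {0..1}"
  using lipschitz_onD[OF W_lip, of "(a, b)" "(a', b)"] that by (auto simp: dist_Pair_Pair dist_real_def)

lemma W_measurable: "W a \<in> borel_measurable unit_lborel" if "a \<in> {0..1}"
proof (rule borel_measurable_unit_continuous)
  show "continuous_on {0..1} (W a)"
    using continuous_on_compose2[OF lipschitz_on_continuous_on[OF W_lip], of "{0..1}" "\<lambda>b. (a, b)"] that
    by (simp add: image_subset_iff continuous_on_Pair)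
qed

lemma W_integrable:
  assumes "integrable unit_lborel m" "a \<in> {0..1}"
  shows "integrable unit_lborel (\<lambda>b. W a b * m b)"
proof -
  obtain C where "C > 0" "\<And>a b. a \<in> {0..1} \<Longrightarrow> b \<in> {0..1} \<Longrightarrow> 0 \<le> W a b \<and> W a b \<le> C"
    using W_bound by blast
  then show ?thesis
    by (intro integrable_mult_bounded[OF W_measurable _ assms(1), of a C]) (use assms in force)+
qed

lemma nbhd_unit: "nbhd W m a x = (\<integral>b. W a b * m b x \<partial>unit_lborel)"
  unfolding nbhd_def set_lebesgue_integral_def by (subst integral_restrict_space) auto

text \<open>Transfers the Lipschitz bound on \<open>W\<close> to neighbourhood integrals; it bounds
  the cost of moving from a grid point to an arbitrary \<alpha>.\<close>

lemma W_integral_diff: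
  assumes m: "integrable unit_lborel m" "\<And>b. b \<in> {0..1} \<Longrightarrow> 0 \<le> m b" and a: "a \<in> {0..1}" "a' \<in> {0..1}"
  shows "\<bar>(\<integral>b. W a b * m b \<partial>unit_lborel) - (\<integral>b. W a' b * m b \<partial>unit_lborel)\<bar>
    \<le> L_W * \<bar>a - a'\<bar> * (\<integral>b. m b \<partial>unit_lborel)"
proof -
  note i = W_integrable[OF m(1) a(1)] W_integrable[OF m(1) a(2)]
  have "\<bar>(\<integral>b. W a b * m b \<partial>unit_lborel) - (\<integral>b. W a' b * m b \<partial>unit_lborel)\<bar>
      = \<bar>\<integral>b. W a b * m b - W a' b * m b \<partial>unit_lborel\<bar>"
    using i by simp
  also have "\<dots> \<le> (\<integral>b. \<bar>W a b * m b - W a' b * m b\<bar> \<partial>unit_lborel)"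
    by (rule integral_abs_bound)
  also have "\<dots> \<le> (\<integral>b. L_W * \<bar>a - a'\<bar> * m b \<partial>unit_lborel)"
  proof (rule integral_mono)
    fix b assume "b \<in> space unit_lborel"
    then have b: "b \<in> {0..1}" by simp
    have "\<bar>W a b * m b - W a' b * m b\<bar> = \<bar>W a b - W a' b\<bar> * m b"
      using m(2)[OF b] by (simp add: left_diff_distrib[symmetric] abs_mult)
    also have "\<dots> \<le> L_W * \<bar>a - a'\<bar> * m b"
      using W_diff[OF a b] m(2)[OF b] by (rule mult_right_mono)
    finally show "\<bar>W a b * m b - W a' b * m b\<bar> \<le> L_W * \<bar>a - a'\<bar> * m b" .
  qed (use i m in auto)
  finally show ?thesis using m(1) by simp
qed

lemma unit_integral_le:
  fixes m :: "real \<Rightarrow> real"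
  assumes "integrable unit_lborel m" "\<And>b. b \<in> {0..1} \<Longrightarrow> m b \<le> c"
  shows "(\<integral>b. m b \<partial>unit_lborel) \<le> c"
proof -
  interpret finite_measure unit_lborel by (rule unit_lborel_finite_measure)
  have "(\<integral>b. m b \<partial>unit_lborel) \<le> (\<integral>b. c \<partial>unit_lborel)"
    by (rule integral_mono) (use assms in auto)
  then show ?thesis using unit_lborel_finite_measure(2) by simp
qed

text \<open>The flow is taken constant on the cells of a grid of mesh 1/N, so it is described by
  finitely many numbers and Brouwer's theorem applies. The fixed-point equation is exact at grid
  points and extends to all \<alpha> with error at most L_W / N. Because the flow takes finitely
  many values, composition with any functional is measurable; this makes joint laws, gaps and kernel
  entries measurable in \<alpha> at once.\<close>

lemma approximate_equilibrium:
  assumes "\<epsilon> > 0"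
  shows "\<exists>g :: real \<Rightarrow> nat \<Rightarrow> 'x \<Rightarrow> real. (\<forall>a. feasible (g a)) \<and>
    (\<forall>F :: _ \<Rightarrow> real. (\<lambda>a. F (g a)) \<in> borel_measurable unit_lborel) \<and>
    (\<forall>t x a. T \<le> t \<longrightarrow> g a t x = 0) \<and>
    (\<forall>t x. \<forall>a\<in>{0..1}. t < T \<longrightarrow>
      \<bar>g a t x - (\<integral>b. W a b * law (g b) (soft \<epsilon> (g b)) t x \<partial>unit_lborel)\<bar> \<le> \<epsilon>)"
proof -
  interpret finite_measure unit_lborel by (rule unit_lborel_finite_measure)
  obtain C where C: "C > 0" "\<And>a b. a \<in> {0..1} \<Longrightarrow> b \<in> {0..1} \<Longrightarrow> 0 \<le> W a b \<and> W a b \<le> C"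
    using W_bound by blast
  have L_W: "0 \<le> L_W" using W_lip by (rule lipschitz_on_nonneg)
  obtain N0 :: nat where N0: "L_W / \<epsilon> < real N0" using reals_Archimedean2 by blast
  define N where "N = Suc N0"
  have N: "N > 0" "L_W / real N \<le> \<epsilon>"
  proof -
    have "L_W / \<epsilon> < real N" using N0 by (simp add: N_def)
    then show "L_W / real N \<le> \<epsilon>" using assms by (simp add: N_def field_simps)
  qed (simp add: N_def)
  \<comment> \<open>There are N + 1 cells, the last one reached at a = 1. Capping at
    \<open>N\<close>, and \<open>nat\<close> sending negative numbers to 0, keep the index in the
    grid for every real \<open>a\<close>.\<close>
  define cell where "cell a = min N (nat \<lfloor>real N * a\<rfloor>)" for a :: real
  \<comment> \<open>Neighbourhood masses are at most \<open>C\<close>, so the unknowns are scaled to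
    [0,1]. The \<open>max\<close> makes the flow feasible for every \<open>z\<close>, including
    points outside the cube.\<close>
  define G :: "(nat \<times> nat \<times> 'x \<Rightarrow> real) \<Rightarrow> nat \<Rightarrow> nat \<Rightarrow> 'x \<Rightarrow> real" where
    "G z k t x = (if t < T then C * max 0 (z (k, t, x)) else 0)" for z k t x
  define m where "m z t x b = law (G z (cell b)) (soft \<epsilon> (G z (cell b))) t x" for z t x b
  define I where "I = {..N} \<times> {..<T} \<times> (UNIV :: 'x set)"
  \<comment> \<open>The self-map of the cube: from \<open>z\<close> to the flow, to the smoothed
    best responses and their laws, and back to rescaled neighbourhood integrals at the grid
    points.\<close>
  define f where "f z = (\<lambda>(k, t, x). (\<integral>b. W (real k / real N) b * m z t x b \<partial>unit_lborel) / C)" for z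
  have G_feas: "feasible (G z k)" for z k
    using C(1) by (auto simp: feasible_def bmeas_vec_def G_def)
  have m01: "m z t x b \<in> {0..1}" for z t x b
    unfolding m_def by (rule law_soft_range[OF G_feas assms])
  have cell_meas: "(\<lambda>a. F (G z (cell a))) \<in> borel_measurable unit_lborel" for F :: "_ \<Rightarrow> real" and z
  proof -
    have "(\<lambda>a::real. \<lfloor>real N * a\<rfloor>) \<in> borel \<rightarrow>\<^sub>M count_space UNIV" by measurable
    then have "(\<lambda>a::real. F (G z (min N (nat \<lfloor>real N * a\<rfloor>)))) \<in> borel_measurable borel"
      by (rule measurable_compose[where g = "\<lambda>j. F (G z (min N (nat j)))"]) simp
    then have "(\<lambda>a. F (G z (cell a))) \<in> borel_measurable lborel" by (simp add: cell_def)
    then show ?thesis by (rule measurable_restrict_space1)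
  qed
  have m_meas: "m z t x \<in> borel_measurable unit_lborel" for z t x
    unfolding m_def by (rule cell_meas)
  have m_int: "integrable unit_lborel (m z t x)" for z t x
    by (rule integrable_const_bound[of _ 1]) (use m01 m_meas in auto)
  have grid: "real k / real N \<in> {0..1}" if "k \<le> N" for k
    using that N by (auto simp: divide_le_eq)
  obtain z where z: "\<And>i. i \<in> I \<Longrightarrow> z i \<in> {0..1}" "\<And>i. i \<in> I \<Longrightarrow> f z i = z i"
  proof (rule brouwer_finite_cube[of I f])
    show "finite I" by (simp add: I_def)
  next
    fix z i assume "i \<in> I"
    then obtain k t x where i: "i = (k, t, x)" "k \<le> N" by (auto simp: I_def)
    note g = grid[OF i(2)]
    have "W (real k / real N) b * m z t x b \<le> C" if "b \<in> {0..1}" for b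
    proof -
      have "W (real k / real N) b * m z t x b \<le> C * 1"
        by (rule mult_mono) (use C(2)[OF g that] m01[of z t x b] C(1) in auto)
      then show ?thesis by simp
    qed
    then have "(\<integral>b. W (real k / real N) b * m z t x b \<partial>unit_lborel) \<le> C"
      by (intro unit_integral_le W_integrable m_int g)
    moreover have "0 \<le> (\<integral>b. W (real k / real N) b * m z t x b \<partial>unit_lborel)"
      by (rule integral_nonneg_AE) (use C(2)[OF g] m01 in \<open>auto intro!: AE_I2\<close>)
    ultimately show "f z i \<in> {0..1}" using C(1) by (simp add: f_def i)
  next
    fix zs :: "nat \<Rightarrow> nat \<times> nat \<times> 'x \<Rightarrow> real" and z i
    assume zs: "\<And>j. j \<in> I \<Longrightarrow> (\<lambda>n. zs n j) \<longlonglongrightarrow> z j" and "i \<in> I"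
    then obtain k t x where i: "i = (k, t, x)" "k \<le> N" by (auto simp: I_def)
    note g = grid[OF i(2)]
    have "conv (\<lambda>n. G (zs n) (cell b)) (G z (cell b))" for b
      unfolding conv_def
    proof (intro conjI allI G_feas)
      fix t x
      \<comment> \<open>Before the horizon the required coordinate lies in \<open>I\<close>, thanks
        to the cap in \<open>cell\<close>; from the horizon on both sides are 0.\<close>
      show "(\<lambda>n. G (zs n) (cell b) t x) \<longlonglongrightarrow> G z (cell b) t x"
        using zs[of "(cell b, t, x)"]
        by (auto simp: G_def I_def cell_def intro!: tendsto_intros tendsto_max)
    qed
    then have m_tendsto: "(\<lambda>n. m (zs n) t x b) \<longlonglongrightarrow> m z t x b" for b
      unfolding m_def by (rule tendsto_law_soft[OF _ assms])
    have "(\<lambda>n. \<integral>b. W (real k / real N) b * m (zs n) t x b \<partial>unit_lborel)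
      \<longlonglongrightarrow> (\<integral>b. W (real k / real N) b * m z t x b \<partial>unit_lborel)"
    proof (rule integral_dominated_convergence[where w = "\<lambda>_. C"])
      show "AE b in unit_lborel. (\<lambda>n. W (real k / real N) b * m (zs n) t x b)
          \<longlonglongrightarrow> W (real k / real N) b * m z t x b"
        by (intro AE_I2 tendsto_intros m_tendsto)
      have "norm (W (real k / real N) b * m (zs n) t x b) \<le> C" if "b \<in> {0..1}" for n b
      proof -
        have "W (real k / real N) b * m (zs n) t x b \<le> C * 1"
          by (rule mult_mono) (use C(2)[OF g that] m01[of "zs n" t x b] C(1) in auto)
        then show ?thesis using C(2)[OF g that] m01[of "zs n" t x b] by simp
      qed
      then show "AE b in unit_lborel. norm (W (real k / real N) b * m (zs n) t x b) \<le> C" for n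
        by (intro AE_I2) simp
    qed (use W_measurable[OF g] m_meas in \<open>auto\<close>)
    then show "(\<lambda>n. f (zs n) i) \<longlonglongrightarrow> f z i"
      unfolding f_def i by (auto intro!: tendsto_divide C(1) simp: C(1)[THEN less_imp_neq, symmetric])
  qed blast
  show ?thesis
  proof (intro exI[of _ "\<lambda>a. G z (cell a)"] conjI allI ballI impI)
    show "feasible (G z (cell a))" for a by (rule G_feas)
    show "(\<lambda>a. F (G z (cell a))) \<in> borel_measurable unit_lborel" for F :: "_ \<Rightarrow> real"
      by (rule cell_meas)
    show "G z (cell a) t x = 0" if "T \<le> t" for a t x using that by (simp add: G_def)
    fix t x and a :: real assume a: "a \<in> {0..1}" and t: "t < T"
    define k where "k = nat \<lfloor>real N * a\<rfloor>"
    have "real N * a \<le> real N" using a by (simp add: mult_left_le)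
    then have kN: "k \<le> N" unfolding k_def by linarith
    then have cell: "cell a = k" by (simp add: cell_def k_def)
    have "0 \<le> real N * a" using a by simp
    then have "real k \<le> real N * a" "real N * a \<le> real k + 1" unfolding k_def by linarith+
    then have "\<bar>real N * a - real k\<bar> / real N \<le> 1 / real N" by (intro divide_right_mono) auto
    moreover have "a - real k / real N = (real N * a - real k) / real N" using N by (simp add: field_simps)
    ultimately have ak: "\<bar>a - real k / real N\<bar> \<le> 1 / real N" by simp
    have mem: "(k, t, x) \<in> I" using kN t by (simp add: I_def)
    \<comment> \<open>The fixed point makes the flow on the cell equal to the neighbourhood integral
      at the grid point k / N; replacing that point by \<open>a\<close> costs only the Lipschitz
      error.\<close>
    have "G z (cell a) t x = C * z (k, t, x)"
      using z(1)[OF mem] t by (simp add: G_def cell)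
    also have "\<dots> = (\<integral>b. W (real k / real N) b * m z t x b \<partial>unit_lborel)"
      using z(2)[OF mem] C(1) by (simp add: f_def field_simps)
    finally have "\<bar>G z (cell a) t x - (\<integral>b. W a b * m z t x b \<partial>unit_lborel)\<bar>
        \<le> L_W * \<bar>real k / real N - a\<bar> * (\<integral>b. m z t x b \<partial>unit_lborel)"
      using W_integral_diff[OF m_int _ grid[OF kN] a] m01 by simp
    also have "\<dots> \<le> L_W * (1 / real N) * 1"
      by (intro mult_mono unit_integral_le m_int)
        (use L_W ak m01 in \<open>auto simp: abs_minus_commute intro!: integral_nonneg_AE\<close>)
    also have "\<dots> \<le> \<epsilon>" using N by simp
    finally show "\<bar>G z (cell a) t x -
        (\<integral>b. W a b * law (G z (cell b)) (soft \<epsilon> (G z (cell b))) t x \<partial>unit_lborel)\<bar> \<le> \<epsilon>"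
      by (simp add: m_def)
  qed
qed

end

section \<open>Passage to the limit\<close>

text \<open>The sign of a function is itself a bounded test function, so identities obtained from
  weak limits become almost-everywhere identities.\<close>

lemma AE_zero_if_sgn_integral_zero:
  fixes d :: "'a \<Rightarrow> real"
  assumes "integrable M d" "(\<integral>x. sgn (d x) * d x \<partial>M) = 0"
  shows "AE x in M. d x = 0"
proof -
  have "(\<integral>x. \<bar>d x\<bar> \<partial>M) = 0" using assms(2) by (simp add: abs_sgn mult.commute)
  then have "AE x in M. \<bar>d x\<bar> = 0"
    using assms(1) by (subst (asm) integral_nonneg_eq_0_iff_AE) auto
  then show ?thesis by simp
qed

text \<open>Since \<open>\<phi> n\<close> is bounded by 1, replacing \<open>h n\<close> by its
  pointwise limit \<open>k\<close> changes the integral by at most that of |h n - k|, which vanishes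
  by dominated convergence.\<close>

lemma weak_strong_tendsto:
  fixes \<phi> h :: "nat \<Rightarrow> real \<Rightarrow> real"
  assumes \<phi>: "\<And>n. \<phi> n \<in> borel_measurable unit_lborel" "\<And>n x. x \<in> {0..1} \<Longrightarrow> \<phi> n x \<in> {0..1}"
    and weak: "(\<lambda>n. \<integral>x. k x * \<phi> n x \<partial>unit_lborel) \<longlonglongrightarrow> c"
    and h: "\<And>n. h n \<in> borel_measurable unit_lborel" "\<And>n x. x \<in> {0..1} \<Longrightarrow> \<bar>h n x\<bar> \<le> B"
    and k: "k \<in> borel_measurable unit_lborel" "\<And>x. x \<in> {0..1} \<Longrightarrow> \<bar>k x\<bar> \<le> B"
    and lim: "\<And>x. x \<in> {0..1} \<Longrightarrow> (\<lambda>n. h n x) \<longlonglongrightarrow> k x"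
  shows "(\<lambda>n. \<integral>x. h n x * \<phi> n x \<partial>unit_lborel) \<longlonglongrightarrow> c"
proof -
  interpret finite_measure unit_lborel by (rule unit_lborel_finite_measure)
  have \<phi>_int: "integrable unit_lborel (\<phi> n)" for n
    by (rule integrable_const_bound[of _ 1]) (use \<phi> in auto)
  have i: "integrable unit_lborel (\<lambda>x. h n x * \<phi> n x)" "integrable unit_lborel (\<lambda>x. k x * \<phi> n x)" for n
    by (rule integrable_mult_bounded[OF _ _ \<phi>_int, of _ B]; use h k in simp)+
  have small: "\<bar>(h n x - k x) * \<phi> n x\<bar> \<le> \<bar>h n x - k x\<bar>" if "x \<in> {0..1}" for n x
    using \<phi>(2)[OF that, of n] by (simp add: abs_mult mult_left_le)
  have "(\<lambda>n. \<integral>x. (h n x - k x) * \<phi> n x \<partial>unit_lborel) \<longlonglongrightarrow> (\<integral>x. 0 \<partial>unit_lborel)"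
  proof (rule integral_dominated_convergence[where w = "\<lambda>_. 2 * B"])
    show "AE x in unit_lborel. (\<lambda>n. (h n x - k x) * \<phi> n x) \<longlonglongrightarrow> 0"
    proof (rule AE_I2)
      fix x assume "x \<in> space unit_lborel"
      then have x: "x \<in> {0..1}" by simp
      have "(\<lambda>n. \<bar>h n x - k x\<bar>) \<longlonglongrightarrow> 0"
        using lim[OF x] by (intro tendsto_rabs_zero LIM_zero)
      then show "(\<lambda>n. (h n x - k x) * \<phi> n x) \<longlonglongrightarrow> 0"
        by (rule Lim_null_comparison[rotated]) (use small[OF x] in simp)
    qed
    have "norm ((h n x - k x) * \<phi> n x) \<le> 2 * B" if "x \<in> {0..1}" for n x
      using small[OF that, of n] h(2)[OF that, of n] k(2)[OF that] unfolding real_norm_def by linarith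
    then show "AE x in unit_lborel. norm ((h n x - k x) * \<phi> n x) \<le> 2 * B" for n
      by (intro AE_I2) simp
  qed (use h \<phi> k in auto)
  then have "(\<lambda>n. (\<integral>x. h n x * \<phi> n x \<partial>unit_lborel) - (\<integral>x. k x * \<phi> n x \<partial>unit_lborel)) \<longlonglongrightarrow> 0"
    using i by (simp add: left_diff_distrib)
  from tendsto_add[OF this weak] show ?thesis by simp
qed

context graphon_game
begin

text \<open>Collects what survives as \<epsilon> tends to 0: \<open>\<rho>\<close> is the weak limit
  of the joint laws and \<open>g\<close> the flow it generates. The dynamics and optimality hold
  only almost everywhere, whereas the identity for \<open>g\<close> holds at every point.\<close>

lemma limit_equilibrium:
  obtains \<rho> :: "nat \<Rightarrow> 'x \<Rightarrow> 'u \<Rightarrow> real \<Rightarrow> real" and g :: "real \<Rightarrow> nat \<Rightarrow> 'x \<Rightarrow> real" where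
    "\<And>t x u. integrable unit_lborel (\<rho> t x u)" "\<And>t x u b. 0 \<le> \<rho> t x u b"
    "\<And>a. a \<in> {0..1} \<Longrightarrow> feasible (g a)"
    "\<And>x u t y. (\<lambda>b. P x u (g b t) y) \<in> borel_measurable unit_lborel"
    "\<And>t x u. (\<lambda>b. gap (g b) t x u) \<in> borel_measurable unit_lborel"
    "\<And>a t x. t < T \<Longrightarrow> g a t x = (\<integral>b. W a b * (\<Sum>u\<in>UNIV. \<rho> t x u b) \<partial>unit_lborel)"
    "\<And>x. AE b in unit_lborel. (\<Sum>u\<in>UNIV. \<rho> 0 x u b) = mu0 x"
    "\<And>t x. AE b in unit_lborel.
       (\<Sum>u\<in>UNIV. \<rho> (Suc t) x u b) = (\<Sum>x'\<in>UNIV. \<Sum>u\<in>UNIV. \<rho> t x' u b * P x' u (g b t) x)"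
    "\<And>t x u. AE b in unit_lborel. \<rho> t x u b * gap (g b) t x u = 0"
proof -
  interpret finite_measure unit_lborel by (rule unit_lborel_finite_measure)
  define \<epsilon> where "\<epsilon> n = 1 / real (Suc n)" for n
  have \<epsilon>: "\<epsilon> n > 0" for n by (simp add: \<epsilon>_def)
  have \<epsilon>0: "\<epsilon> \<longlonglongrightarrow> 0"
    unfolding \<epsilon>_def using LIMSEQ_inverse_real_of_nat by (simp add: inverse_eq_divide)
  have "\<exists>G :: nat \<Rightarrow> real \<Rightarrow> nat \<Rightarrow> 'x \<Rightarrow> real. \<forall>n. (\<forall>a. feasible (G n a)) \<and>
    (\<forall>F :: _ \<Rightarrow> real. (\<lambda>a. F (G n a)) \<in> borel_measurable unit_lborel) \<and>
    (\<forall>t x a. T \<le> t \<longrightarrow> G n a t x = 0) \<and>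
    (\<forall>t x. \<forall>a\<in>{0..1}. t < T \<longrightarrow>
      \<bar>G n a t x - (\<integral>b. W a b * law (G n b) (soft (\<epsilon> n) (G n b)) t x \<partial>unit_lborel)\<bar> \<le> \<epsilon> n)"
    by (intro choice allI approximate_equilibrium \<epsilon>)
  then obtain G :: "nat \<Rightarrow> real \<Rightarrow> nat \<Rightarrow> 'x \<Rightarrow> real" where G: "\<forall>n. (\<forall>a. feasible (G n a)) \<and>
    (\<forall>F :: _ \<Rightarrow> real. (\<lambda>a. F (G n a)) \<in> borel_measurable unit_lborel) \<and>
    (\<forall>t x a. T \<le> t \<longrightarrow> G n a t x = 0) \<and>
    (\<forall>t x. \<forall>a\<in>{0..1}. t < T \<longrightarrow>
      \<bar>G n a t x - (\<integral>b. W a b * law (G n b) (soft (\<epsilon> n) (G n b)) t x \<partial>unit_lborel)\<bar> \<le> \<epsilon> n)"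
    by (elim exE)
  have G_feas: "feasible (G n a)" and G_meas: "(\<lambda>a. F (G n a)) \<in> borel_measurable unit_lborel"
    and G_0: "T \<le> t \<Longrightarrow> G n a t x = 0"
    and G_eq: "a \<in> {0..1} \<Longrightarrow> t < T \<Longrightarrow>
      \<bar>G n a t x - (\<integral>b. W a b * law (G n b) (soft (\<epsilon> n) (G n b)) t x \<partial>unit_lborel)\<bar> \<le> \<epsilon> n"
    for n a t x and F :: "(nat \<Rightarrow> 'x \<Rightarrow> real) \<Rightarrow> real"
    using G by auto
  \<comment> \<open>Time, state and action are packed into one countable index, so that a single
    subsequence works for all of them.\<close>
  define \<phi> where "\<phi> n = (\<lambda>(t, x, u) b. occ (\<epsilon> n) (G n b) t x u)" for n
  have \<phi>_meas: "\<phi> n k \<in> borel_measurable unit_lborel" for n k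
    using G_meas[of "\<lambda>h. occ (\<epsilon> n) h (fst k) (fst (snd k)) (snd (snd k))" n]
    by (simp add: \<phi>_def case_prod_unfold)
  have \<phi>_01: "\<phi> n k b \<in> {0..1}" for n k b
    using occ_range[OF G_feas \<epsilon>] by (simp add: \<phi>_def case_prod_unfold)
  obtain \<sigma> \<rho>' where \<sigma>: "strict_mono (\<sigma> :: nat \<Rightarrow> nat)"
    and \<rho>'_int: "\<And>k. integrable unit_lborel (\<rho>' k)" and \<rho>'_nn: "\<And>k x. 0 \<le> \<rho>' k x"
    and weak: "\<And>k h B. h \<in> borel_measurable unit_lborel \<Longrightarrow> (\<And>x. x \<in> {0..1} \<Longrightarrow> \<bar>h x\<bar> \<le> B) \<Longrightarrow>
      (\<lambda>n. \<integral>x. h x * \<phi> (\<sigma> n) k x \<partial>unit_lborel) \<longlonglongrightarrow> (\<integral>x. h x * \<rho>' k x \<partial>unit_lborel)"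
    by (rule weak_compactness_unit_interval[of \<phi>, OF \<phi>_meas \<phi>_01]) auto
  define \<rho> where "\<rho> t x u = \<rho>' (t, x, u)" for t x u
  define \<psi> where "\<psi> n t x u b = occ (\<epsilon> (\<sigma> n)) (G (\<sigma> n) b) t x u" for n t x u b
  have \<rho>_int: "integrable unit_lborel (\<rho> t x u)" and \<rho>_nn: "0 \<le> \<rho> t x u b" for t x u b
    using \<rho>'_int \<rho>'_nn by (auto simp: \<rho>_def)
  have \<psi>_meas: "\<psi> n t x u \<in> borel_measurable unit_lborel" and \<psi>_01: "\<psi> n t x u b \<in> {0..1}" for n t x u b
    using \<phi>_meas[of "\<sigma> n" "(t, x, u)"] \<phi>_01[of "\<sigma> n" "(t, x, u)" b]
    by (auto simp: \<phi>_def \<psi>_def[abs_def])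
  have \<psi>_int: "integrable unit_lborel (\<psi> n t x u)" for n t x u
    by (rule integrable_const_bound[of _ 1]) (use \<psi>_meas \<psi>_01 in auto)
  have weak\<psi>: "(\<lambda>n. \<integral>b. h b * \<psi> n t x u b \<partial>unit_lborel) \<longlonglongrightarrow> (\<integral>b. h b * \<rho> t x u b \<partial>unit_lborel)"
    if "h \<in> borel_measurable unit_lborel" "\<And>b. b \<in> {0..1} \<Longrightarrow> \<bar>h b\<bar> \<le> B" for h B t x u
    using weak[OF that, of "(t, x, u)"] by (simp add: \<phi>_def \<psi>_def \<rho>_def)
  have weak_sum: "(\<lambda>n. \<integral>b. h b * (\<Sum>u\<in>UNIV. \<psi> n t x u b) \<partial>unit_lborel)
      \<longlonglongrightarrow> (\<integral>b. h b * (\<Sum>u\<in>UNIV. \<rho> t x u b) \<partial>unit_lborel)"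
    if h: "h \<in> borel_measurable unit_lborel" "\<And>b. b \<in> {0..1} \<Longrightarrow> \<bar>h b\<bar> \<le> B" for h B t x
  proof -
    have eq: "(\<integral>b. h b * (\<Sum>u\<in>UNIV. f u b) \<partial>unit_lborel) = (\<Sum>u\<in>UNIV. \<integral>b. h b * f u b \<partial>unit_lborel)"
      if "\<And>u. integrable unit_lborel (f u)" for f :: "'u \<Rightarrow> real \<Rightarrow> real"
      unfolding sum_distrib_left
      by (rule Bochner_Integration.integral_sum)
        (rule integrable_mult_bounded[OF h(1) _ that, of B], use h(2) in simp)
    show ?thesis
      unfolding eq[OF \<psi>_int] eq[OF \<rho>_int] by (intro tendsto_intros weak\<psi>[OF h])
  qed
  have \<psi>_sum: "(\<Sum>u\<in>UNIV. \<psi> n t x u b) = law (G (\<sigma> n) b) (soft (\<epsilon> (\<sigma> n)) (G (\<sigma> n) b)) t x" for n t x b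
    unfolding \<psi>_def by (rule occ_flow[OF \<epsilon>])
  have \<epsilon>\<sigma>: "(\<lambda>n. \<epsilon> (\<sigma> n)) \<longlonglongrightarrow> 0"
    using LIMSEQ_subseq_LIMSEQ[OF \<epsilon>0 \<sigma>] by (simp add: o_def)
  define g where "g a t x = (if t < T then \<integral>b. W a b * (\<Sum>u\<in>UNIV. \<rho> t x u b) \<partial>unit_lborel else 0)" for a t x
  obtain C where C: "C > 0" "\<And>a b. a \<in> {0..1} \<Longrightarrow> b \<in> {0..1} \<Longrightarrow> 0 \<le> W a b \<and> W a b \<le> C"
    using W_bound by blast
  \<comment> \<open>For fixed \<open>a\<close> the function \<open>W a\<close> is a bounded test
    function, so weak convergence of the laws gives convergence of the flow at every
    \<open>a\<close>, not merely almost everywhere.\<close>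
  have G_lim: "(\<lambda>n. G (\<sigma> n) a t x) \<longlonglongrightarrow> g a t x" if a: "a \<in> {0..1}" for a t x
  proof (cases "t < T")
    case True
    have "(\<lambda>n. \<integral>b. W a b * (\<Sum>u\<in>UNIV. \<psi> n t x u b) \<partial>unit_lborel) \<longlonglongrightarrow> g a t x"
      using weak_sum[OF W_measurable[OF a], of C t x] C(2)[OF a] True by (simp add: g_def)
    moreover have "(\<lambda>n. G (\<sigma> n) a t x - (\<integral>b. W a b * (\<Sum>u\<in>UNIV. \<psi> n t x u b) \<partial>unit_lborel)) \<longlonglongrightarrow> 0"
      by (rule Lim_null_comparison[OF _ \<epsilon>\<sigma>]) (use G_eq[OF a True] in \<open>simp add: \<psi>_sum\<close>)
    ultimately show ?thesis using tendsto_add by fastforce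
  qed (simp add: g_def G_0)
  have g_feas: "feasible (g a)" if a: "a \<in> {0..1}" for a
    unfolding feasible_def bmeas_vec_def
  proof (intro allI)
    fix t x
    show "0 \<le> g a t x"
      using G_lim[OF a] by (rule LIMSEQ_le_const) (use G_feas in \<open>auto simp: feasible_def bmeas_vec_def\<close>)
  qed
  have conv: "conv (\<lambda>n. G (\<sigma> n) b) (g b)" if "b \<in> {0..1}" for b
    using G_feas g_feas[OF that] G_lim[OF that] by (auto simp: conv_def)
  \<comment> \<open>Measurability is inherited from the approximate flows as a pointwise
    limit.\<close>
  have P_meas: "(\<lambda>b. P x u (g b t) y) \<in> borel_measurable unit_lborel" for x u t y
    by (rule borel_measurable_LIMSEQ_real[of _ "\<lambda>n b. P x u (G (\<sigma> n) b t) y"])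
      (use tendsto_P[OF conv] G_meas[of "\<lambda>h. P x u (h t) y"] in auto)
  have gap_meas: "(\<lambda>b. gap (g b) t x u) \<in> borel_measurable unit_lborel" for x u t
    by (rule borel_measurable_LIMSEQ_real[of _ "\<lambda>n b. gap (G (\<sigma> n) b) t x u"])
      (use tendsto_gap[OF conv] G_meas[of "\<lambda>h. gap h t x u"] in auto)
  have P01: "\<bar>P x u (h t) y\<bar> \<le> 1" if "feasible h" for x u y h and t :: nat
    using P[of "h t" x u] prob_vec_le_1[of "P x u (h t)" y] that by (auto simp: feasible_def prob_vec_def)
  have sum_int: "integrable unit_lborel (\<lambda>b. \<Sum>u\<in>UNIV. \<rho> t x u b)" for t x
    using \<rho>_int by auto
  have \<rho>P_int: "integrable unit_lborel (\<lambda>b. P x' u (g b t) x * \<rho> t x' u b)" for x' u t x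
    by (rule integrable_mult_bounded[OF P_meas _ \<rho>_int, of _ _ _ _ 1]) (use P01[OF g_feas] in simp)
  have init: "AE b in unit_lborel. (\<Sum>u\<in>UNIV. \<rho> 0 x u b) = mu0 x" for x
  proof -
    define d where "d b = (\<Sum>u\<in>UNIV. \<rho> 0 x u b) - mu0 x" for b
    have d_int: "integrable unit_lborel d" unfolding d_def using sum_int by auto
    then have s: "(\<lambda>b. sgn (d b)) \<in> borel_measurable unit_lborel" by measurable
    have sb: "\<bar>sgn (d b)\<bar> \<le> 1" for b by (simp add: sgn_if)
    \<comment> \<open>All approximations start from \<open>mu0\<close>, so the weakly convergent
      sequence is constant.\<close>
    have "(\<lambda>n::nat. \<integral>b. sgn (d b) * mu0 x \<partial>unit_lborel) \<longlonglongrightarrow> (\<integral>b. sgn (d b) * (\<Sum>u\<in>UNIV. \<rho> 0 x u b) \<partial>unit_lborel)"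
      using weak_sum[OF s sb, of 0 x] by (simp add: \<psi>_sum)
    then have eq: "(\<integral>b. sgn (d b) * mu0 x \<partial>unit_lborel) = (\<integral>b. sgn (d b) * (\<Sum>u\<in>UNIV. \<rho> 0 x u b) \<partial>unit_lborel)"
      using LIMSEQ_unique[OF tendsto_const] by blast
    have "(\<integral>b. sgn (d b) * d b \<partial>unit_lborel) =
        (\<integral>b. sgn (d b) * (\<Sum>u\<in>UNIV. \<rho> 0 x u b) - sgn (d b) * mu0 x \<partial>unit_lborel)"
      by (rule Bochner_Integration.integral_cong) (simp_all add: d_def right_diff_distrib)
    also have "\<dots> = (\<integral>b. sgn (d b) * (\<Sum>u\<in>UNIV. \<rho> 0 x u b) \<partial>unit_lborel)
        - (\<integral>b. sgn (d b) * mu0 x \<partial>unit_lborel)"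
      by (rule Bochner_Integration.integral_diff)
        (rule integrable_mult_bounded[OF s, of 1]; use sb sum_int in simp)+
    finally have "(\<integral>b. sgn (d b) * d b \<partial>unit_lborel) = 0" using eq by simp
    then have "AE b in unit_lborel. d b = 0"
      by (rule AE_zero_if_sgn_integral_zero[OF d_int])
    then show ?thesis by (simp add: d_def)
  qed
  have flow: "AE b in unit_lborel.
       (\<Sum>u\<in>UNIV. \<rho> (Suc t) x u b) = (\<Sum>x'\<in>UNIV. \<Sum>u\<in>UNIV. \<rho> t x' u b * P x' u (g b t) x)" for t x
  proof -
    \<comment> \<open>\<open>d\<close> is the defect in the forward equation. The approximations
      satisfy that equation exactly; testing it with the sign of \<open>d\<close> and passing to the
      limit shows that \<open>d\<close> vanishes almost everywhere.\<close>
    define D where "D b = (\<Sum>x'\<in>UNIV. \<Sum>u\<in>UNIV. P x' u (g b t) x * \<rho> t x' u b)" for b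
    define d where "d b = (\<Sum>u\<in>UNIV. \<rho> (Suc t) x u b) - D b" for b
    have D_int: "integrable unit_lborel D" unfolding D_def using \<rho>P_int by auto
    have d_int: "integrable unit_lborel d" unfolding d_def using sum_int D_int by auto
    then have s[measurable]: "(\<lambda>b. sgn (d b)) \<in> borel_measurable unit_lborel" by measurable
    have sb: "\<bar>sgn (d b)\<bar> \<le> 1" for b by (simp add: sgn_if)
    have sP_b: "\<bar>sgn (d b) * P x' u (h t) x\<bar> \<le> 1" if "feasible h" for b h x' u
      using mult_mono[OF sb P01[OF that]] by (simp add: abs_mult)
    \<comment> \<open>The kernel converges pointwise along the flows and the joint law converges
      weakly, so their product passes to the limit.\<close>
    have lim1: "(\<lambda>n. \<integral>b. (sgn (d b) * P x' u (G (\<sigma> n) b t) x) * \<psi> n t x' u b \<partial>unit_lborel)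
        \<longlonglongrightarrow> (\<integral>b. (sgn (d b) * P x' u (g b t) x) * \<rho> t x' u b \<partial>unit_lborel)" for x' u
    proof (rule weak_strong_tendsto[where k = "\<lambda>b. sgn (d b) * P x' u (g b t) x" and B = 1])
      show m: "(\<lambda>b. sgn (d b) * P x' u (g b t) x) \<in> borel_measurable unit_lborel"
        using s P_meas by (rule borel_measurable_times)
      show "(\<lambda>n. \<integral>b. (sgn (d b) * P x' u (g b t) x) * \<psi> n t x' u b \<partial>unit_lborel)
        \<longlonglongrightarrow> (\<integral>b. (sgn (d b) * P x' u (g b t) x) * \<rho> t x' u b \<partial>unit_lborel)"
        by (rule weak\<psi>[OF m sP_b[OF g_feas]])
      show "(\<lambda>b. sgn (d b) * P x' u (G (\<sigma> n) b t) x) \<in> borel_measurable unit_lborel" for n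
        using s G_meas[of "\<lambda>h. P x' u (h t) x"] by (rule borel_measurable_times)
      show "(\<lambda>n. sgn (d b) * P x' u (G (\<sigma> n) b t) x) \<longlonglongrightarrow> sgn (d b) * P x' u (g b t) x" if "b \<in> {0..1}" for b
        by (intro tendsto_intros tendsto_P conv that)
    qed (use \<psi>_meas \<psi>_01 sP_b G_feas g_feas in auto)
    have eq1: "(\<integral>b. sgn (d b) * (\<Sum>u\<in>UNIV. \<psi> n (Suc t) x u b) \<partial>unit_lborel) =
       (\<Sum>x'\<in>UNIV. \<Sum>u\<in>UNIV. \<integral>b. (sgn (d b) * P x' u (G (\<sigma> n) b t) x) * \<psi> n t x' u b \<partial>unit_lborel)" for n
    proof -
      have i: "integrable unit_lborel (\<lambda>b. (sgn (d b) * P x' u (G (\<sigma> n) b t) x) * \<psi> n t x' u b)" for x' u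
        by (rule integrable_mult_bounded[OF _ _ \<psi>_int, of _ 1])
          (use sP_b[OF G_feas] s G_meas[of "\<lambda>h. P x' u (h t) x"] in auto)
      have "(\<integral>b. sgn (d b) * (\<Sum>u\<in>UNIV. \<psi> n (Suc t) x u b) \<partial>unit_lborel) =
        (\<integral>b. (\<Sum>x'\<in>UNIV. \<Sum>u\<in>UNIV. (sgn (d b) * P x' u (G (\<sigma> n) b t) x) * \<psi> n t x' u b) \<partial>unit_lborel)"
        unfolding \<psi>_sum law_soft_Suc by (simp add: \<psi>_def sum_distrib_left mult_ac)
      then show ?thesis using i by (simp add: Bochner_Integration.integral_sum)
    qed
    have "(\<lambda>n. \<integral>b. sgn (d b) * (\<Sum>u\<in>UNIV. \<psi> n (Suc t) x u b) \<partial>unit_lborel) \<longlonglongrightarrow>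
       (\<Sum>x'\<in>UNIV. \<Sum>u\<in>UNIV. \<integral>b. (sgn (d b) * P x' u (g b t) x) * \<rho> t x' u b \<partial>unit_lborel)"
      unfolding eq1 by (intro tendsto_sum lim1)
    from LIMSEQ_unique[OF this weak_sum[OF s sb]]
    have eq2: "(\<Sum>x'\<in>UNIV. \<Sum>u\<in>UNIV. \<integral>b. (sgn (d b) * P x' u (g b t) x) * \<rho> t x' u b \<partial>unit_lborel) =
       (\<integral>b. sgn (d b) * (\<Sum>u\<in>UNIV. \<rho> (Suc t) x u b) \<partial>unit_lborel)" .
    have i: "integrable unit_lborel (\<lambda>b. sgn (d b) * (P x' u (g b t) x * \<rho> t x' u b))" for x' u
      by (rule integrable_mult_bounded[OF s _ \<rho>P_int, of 1]) (use sb in simp)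
    have "(\<integral>b. sgn (d b) * D b \<partial>unit_lborel) =
       (\<Sum>x'\<in>UNIV. \<Sum>u\<in>UNIV. \<integral>b. (sgn (d b) * P x' u (g b t) x) * \<rho> t x' u b \<partial>unit_lborel)"
      unfolding D_def sum_distrib_left using i by (simp add: Bochner_Integration.integral_sum mult.assoc)
    moreover have "(\<integral>b. sgn (d b) * d b \<partial>unit_lborel) =
        (\<integral>b. sgn (d b) * (\<Sum>u\<in>UNIV. \<rho> (Suc t) x u b) - sgn (d b) * D b \<partial>unit_lborel)"
      by (rule Bochner_Integration.integral_cong) (simp_all add: d_def right_diff_distrib)
    moreover have "\<dots> = (\<integral>b. sgn (d b) * (\<Sum>u\<in>UNIV. \<rho> (Suc t) x u b) \<partial>unit_lborel)
        - (\<integral>b. sgn (d b) * D b \<partial>unit_lborel)"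
      by (rule Bochner_Integration.integral_diff)
        (rule integrable_mult_bounded[OF s, of 1]; use sb sum_int D_int in simp)+
    ultimately have "AE b in unit_lborel. d b = 0"
      using AE_zero_if_sgn_integral_zero[OF d_int] eq2 by simp
    then show ?thesis by (simp add: d_def D_def mult.commute)
  qed
  have opt: "AE b in unit_lborel. \<rho> t x u b * gap (g b) t x u = 0" for t x u
  proof -
    \<comment> \<open>The truncation supplies the uniform bound needed for weak-strong convergence.\<close>
    define k where "k h = min 1 (gap h t x u)" for h
    have k: "\<bar>k h\<bar> \<le> 1" "0 \<le> k h" for h using gap_nonneg[of h t x u] by (auto simp: k_def)
    have km: "(\<lambda>b. k (g b)) \<in> borel_measurable unit_lborel"
      unfolding k_def using gap_meas by measurable
    have "(\<lambda>n. \<integral>b. k (G (\<sigma> n) b) * \<psi> n t x u b \<partial>unit_lborel) \<longlonglongrightarrow> (\<integral>b. k (g b) * \<rho> t x u b \<partial>unit_lborel)"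
    proof (rule weak_strong_tendsto[where k = "\<lambda>b. k (g b)" and B = 1])
      show "(\<lambda>n. \<integral>b. k (g b) * \<psi> n t x u b \<partial>unit_lborel) \<longlonglongrightarrow> (\<integral>b. k (g b) * \<rho> t x u b \<partial>unit_lborel)"
        by (rule weak\<psi>[OF km k(1)])
      show "(\<lambda>n. k (G (\<sigma> n) b)) \<longlonglongrightarrow> k (g b)" if "b \<in> {0..1}" for b
        unfolding k_def by (intro tendsto_min tendsto_const tendsto_gap conv that)
    qed (use \<psi>_meas \<psi>_01 k km G_meas in auto)
    moreover have "(\<lambda>n. \<integral>b. k (G (\<sigma> n) b) * \<psi> n t x u b \<partial>unit_lborel) \<longlonglongrightarrow> 0"
    proof (rule tendsto_sandwich[OF _ _ tendsto_const \<epsilon>\<sigma>])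
      have nn: "0 \<le> k (G (\<sigma> n) b) * \<psi> n t x u b" for n b
        using k(2) \<psi>_01[of n t x u b] by simp
      then show "\<forall>\<^sub>F n in sequentially. 0 \<le> (\<integral>b. k (G (\<sigma> n) b) * \<psi> n t x u b \<partial>unit_lborel)"
        by (intro always_eventually allI integral_nonneg_AE AE_I2)
      have "k (G (\<sigma> n) b) * \<psi> n t x u b \<le> \<epsilon> (\<sigma> n)" for n b
      proof -
        have "k (G (\<sigma> n) b) * \<psi> n t x u b \<le> gap (G (\<sigma> n) b) t x u * \<psi> n t x u b"
          by (rule mult_right_mono) (use \<psi>_01[of n t x u b] in \<open>auto simp: k_def\<close>)
        also have "\<dots> \<le> \<epsilon> (\<sigma> n)"
          using occ_gap[OF G_feas \<epsilon>, of "\<sigma> n" "\<sigma> n" b t x u] by (simp add: \<psi>_def mult.commute)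
        finally show ?thesis .
      qed
      then show "\<forall>\<^sub>F n in sequentially. (\<integral>b. k (G (\<sigma> n) b) * \<psi> n t x u b \<partial>unit_lborel) \<le> \<epsilon> (\<sigma> n)"
        by (intro always_eventually allI unit_integral_le integrable_mult_bounded[OF G_meas _ \<psi>_int, of k _ 1])
          (use k in auto)
    qed
    ultimately have z: "(\<integral>b. k (g b) * \<rho> t x u b \<partial>unit_lborel) = 0"
      by (rule LIMSEQ_unique)
    have "integrable unit_lborel (\<lambda>b. k (g b) * \<rho> t x u b)"
      by (rule integrable_mult_bounded[OF km _ \<rho>_int, of 1]) (use k in auto)
    then have "AE b in unit_lborel. k (g b) * \<rho> t x u b = 0"
      using z k(2) \<rho>_nn by (subst (asm) integral_nonneg_eq_0_iff_AE) auto
    then show ?thesis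
    proof eventually_elim
      case (elim b)
      \<comment> \<open>Truncation at 1 does not affect where the gap is zero.\<close>
      then show ?case using gap_nonneg[of "g b" t x u] by (auto simp: k_def min_def split: if_splits)
    qed
  qed
  show thesis
    by (rule that[of \<rho> g]) (fact \<rho>_int \<rho>_nn g_feas P_meas gap_meas init flow opt | simp add: g_def)+
qed

end

section \<open>Disintegration of the limit and the exact equilibrium\<close>

context graphon_game
begin

lemma law_cong: "(\<And>s. s < t \<Longrightarrow> h s = h' s) \<Longrightarrow> law h pol t = law h' pol t"
  by (induction t) simp_all

lemma agent_law_eq: "agent_law W P mu0 mus a pol t = law (\<lambda>t. nbhd W (\<lambda>b. mus b t) a) pol t"
  by (induction t) simp_all

lemma psi_mf_eq: "psi_mf W P mu0 pis t a = law (\<lambda>t. nbhd W (psi_mf W P mu0 pis t) a) (pis a) t"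
  by (induction t) simp_all

lemma J_obj_eq:
  assumes "\<And>t. t < T \<Longrightarrow> nbhd W (\<lambda>b. mus b t) a = h t"
  shows "J_obj W P r mu0 T mus a pol =
    (\<Sum>t<T. \<Sum>x\<in>UNIV. law h pol t x * (\<Sum>u\<in>UNIV. pol t x u * r x u (h t)))"
proof -
  have "agent_law W P mu0 mus a pol t = law h pol t" if "t < T" for t
    unfolding agent_law_eq using that assms by (intro law_cong) auto
  then show ?thesis unfolding J_obj_def using assms by (intro sum.cong) auto
qed

text \<open>In \<open>reward_decomposition\<close> both policies share the optimal value; the gap
  term is 0 for the greedy policy and nonnegative for its competitor.\<close>

lemma greedy_optimal:
  assumes "feasible h" "is_policy T pol" "is_policy T pol'"
    and "\<And>t x u. pol t x u * gap h t x u = 0"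
    and "\<And>t. t < T \<Longrightarrow> nbhd W (\<lambda>b. mus b t) a = h t"
  shows "J_obj W P r mu0 T mus a pol' \<le> J_obj W P r mu0 T mus a pol"
proof -
  have pol: "\<And>t x. t < T \<Longrightarrow> prob_vec (pol t x)" "\<And>t x. t < T \<Longrightarrow> prob_vec (pol' t x)"
    using assms by (auto simp: is_policy_def)
  have "0 \<le> (\<Sum>t<T. \<Sum>x\<in>UNIV. law h pol' t x * (\<Sum>u\<in>UNIV. pol' t x u * gap h t x u))"
    using pol(2) law_prob[OF assms(1), of _ pol'] gap_nonneg
    by (intro sum_nonneg mult_nonneg_nonneg) (auto simp: prob_vec_def)
  moreover have "J_obj W P r mu0 T mus a q = (\<Sum>x\<in>UNIV. mu0 x * val h T x) -
      (\<Sum>t<T. \<Sum>x\<in>UNIV. law h q t x * (\<Sum>u\<in>UNIV. q t x u * gap h t x u))"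
    if "\<And>t x. t < T \<Longrightarrow> prob_vec (q t x)" for q
    using J_obj_eq[of mus a h q] reward_decomposition[of h q] assms(1,5) that by simp
  moreover have "(\<Sum>u\<in>UNIV. pol t x u * gap h t x u) = 0" for t x
    using assms(4) by (intro sum.neutral) blast
  ultimately show ?thesis using pol by simp
qed

theorem GMFE_exists: "\<exists>pis mus. is_GMFE W P r mu0 T pis mus"
proof -
  obtain \<rho> :: "nat \<Rightarrow> 'x \<Rightarrow> 'u \<Rightarrow> real \<Rightarrow> real" and g :: "real \<Rightarrow> nat \<Rightarrow> 'x \<Rightarrow> real" where
    \<rho>_int: "\<And>t x u. integrable unit_lborel (\<rho> t x u)" and \<rho>_nn: "\<And>t x u b. 0 \<le> \<rho> t x u b"
    and g_feas: "\<And>a. a \<in> {0..1} \<Longrightarrow> feasible (g a)"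
    and P_meas[measurable]: "\<And>x u t y. (\<lambda>b. P x u (g b t) y) \<in> borel_measurable unit_lborel"
    and gap_meas[measurable]: "\<And>t x u. (\<lambda>b. gap (g b) t x u) \<in> borel_measurable unit_lborel"
    and g_eq: "\<And>a t x. t < T \<Longrightarrow> g a t x = (\<integral>b. W a b * (\<Sum>u\<in>UNIV. \<rho> t x u b) \<partial>unit_lborel)"
    and init: "\<And>x. AE b in unit_lborel. (\<Sum>u\<in>UNIV. \<rho> 0 x u b) = mu0 x"
    and flow: "\<And>t x. AE b in unit_lborel.
       (\<Sum>u\<in>UNIV. \<rho> (Suc t) x u b) = (\<Sum>x'\<in>UNIV. \<Sum>u\<in>UNIV. \<rho> t x' u b * P x' u (g b t) x)"
    and opt: "\<And>t x u. AE b in unit_lborel. \<rho> t x u b * gap (g b) t x u = 0"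
    by (rule limit_equilibrium) blast
  have \<rho>_meas[measurable]: "\<rho> t x u \<in> borel_measurable unit_lborel" for t x u
    using \<rho>_int by auto
  define tot where "tot t x b = (\<Sum>u\<in>UNIV. \<rho> t x u b)" for t x b
  define unif where "unif b t x u =
    (if gap (g b) t x u = 0 then 1 else 0) / (\<Sum>v\<in>UNIV. if gap (g b) t x v = 0 then 1 else (0::real))" for b t x u
  \<comment> \<open>The test is made at each point, not almost everywhere, so the policy has zero
    gap for every \<alpha>, as equilibrium requires. The fallback covers states of mass zero and the
    exceptional null set; it is well defined because some action is always optimal.\<close>
  define pis where "pis b t x u =
    (if 0 < tot t x b \<and> (\<Sum>v\<in>UNIV. \<rho> t x v b * gap (g b) t x v) = 0
     then \<rho> t x u b / tot t x b else unif b t x u)" for b t x u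
  have tot_meas[measurable]: "tot t x \<in> borel_measurable unit_lborel" for t x
    unfolding tot_def by measurable
  have pis_meas[measurable]: "(\<lambda>b. pis b t x u) \<in> borel_measurable unit_lborel" for t x u
    unfolding pis_def unif_def by measurable
  have unif_prob: "prob_vec (unif b t x)" for b t x
  proof -
    obtain u where "gap (g b) t x u = 0" using gap_attained by blast
    then have "1 \<le> (\<Sum>v\<in>UNIV. if gap (g b) t x v = 0 then 1 else (0::real))"
      using member_le_sum[of u UNIV "\<lambda>v. if gap (g b) t x v = 0 then 1 else (0::real)"] by simp
    then show ?thesis
      unfolding prob_vec_def unif_def by (auto simp: sum_divide_distrib[symmetric])
  qed
  have pis_prob: "prob_vec (pis b t x)" for b t x
  proof (cases "0 < tot t x b \<and> (\<Sum>v\<in>UNIV. \<rho> t x v b * gap (g b) t x v) = 0")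
    case True
    then have "pis b t x = (\<lambda>u. \<rho> t x u b / tot t x b)" by (simp add: pis_def fun_eq_iff)
    then show ?thesis using True \<rho>_nn
      by (simp add: prob_vec_def sum_divide_distrib[symmetric] tot_def[symmetric])
  next
    case False
    then have "pis b t x = unif b t x" by (auto simp: pis_def fun_eq_iff)
    then show ?thesis using unif_prob by simp
  qed
  have pis_gap: "pis b t x u * gap (g b) t x u = 0" for b t x u
  proof (cases "0 < tot t x b \<and> (\<Sum>v\<in>UNIV. \<rho> t x v b * gap (g b) t x v) = 0")
    case True
    then have "\<rho> t x u b * gap (g b) t x u = 0"
      using \<rho>_nn gap_nonneg by (subst (asm) sum_nonneg_eq_0_iff) auto
    then show ?thesis using True by (simp add: pis_def)
  qed (auto simp: pis_def unif_def)
  \<comment> \<open>Off a null set the fallback is used only at mass zero, where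
    \<open>\<rho>\<close> itself vanishes.\<close>
  have tot_pis: "AE b in unit_lborel. tot t x b * pis b t x u = \<rho> t x u b" for t x u
  proof -
    have "AE b in unit_lborel. \<forall>v. \<rho> t x v b * gap (g b) t x v = 0"
      using opt by (simp add: AE_all_countable)
    then show ?thesis
    proof eventually_elim
      case (elim b)
      show ?case
      proof (cases "0 < tot t x b")
        case False
        then have "tot t x b = 0" using \<rho>_nn by (simp add: tot_def order_antisym sum_nonneg not_less)
        moreover from this have "\<rho> t x u b = 0"
          unfolding tot_def using \<rho>_nn by (subst (asm) sum_nonneg_eq_0_iff) auto
        ultimately show ?thesis by simp
      next
        case True
        moreover have "(\<Sum>v\<in>UNIV. \<rho> t x v b * gap (g b) t x v) = 0"
          by (rule sum.neutral) (use elim in blast)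
        ultimately show ?thesis by (simp add: pis_def)
      qed
    qed
  qed
  define mus where "mus b t = psi_mf W P mu0 pis t b" for b t
  \<comment> \<open>A neighbourhood field is an integral over the ensemble, so agreement of the
    masses almost everywhere fixes it at every \<open>a\<close>.\<close>
  have nbhd_step: "nbhd W (psi_mf W P mu0 pis t) a = g a t"
    if t: "t < T" and m: "\<And>x. (\<lambda>b. psi_mf W P mu0 pis t b x) \<in> borel_measurable unit_lborel"
      and ae: "\<And>x. AE b in unit_lborel. psi_mf W P mu0 pis t b x = tot t x b" and a: "a \<in> {0..1}" for t a
  proof
    fix x
    show "nbhd W (psi_mf W P mu0 pis t) a x = g a t x"
      unfolding nbhd_unit g_eq[OF t] tot_def[symmetric]
      by (rule integral_cong_AE)
        (use W_measurable[OF a] m[of x] ae[of x] in \<open>auto elim!: eventually_mono\<close>)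
  qed
  \<comment> \<open>Both claims are proved together: measurability and almost-everywhere agreement
    at time \<open>t\<close> identify the neighbourhood field with \<open>g\<close>, after which the
    next step of the recursion is explicit.\<close>
  have main: "(\<forall>x. (\<lambda>b. psi_mf W P mu0 pis t b x) \<in> borel_measurable unit_lborel) \<and>
      (\<forall>x. AE b in unit_lborel. psi_mf W P mu0 pis t b x = tot t x b)" if "t < T" for t
    using that
  proof (induction t)
    case 0
    have "AE b in unit_lborel. mu0 x = tot 0 x b" for x
      using init[of x] by eventually_elim (simp add: tot_def)
    then show ?case by simp
  next
    case (Suc t)
    then have t: "t < T" and IH1[measurable]: "\<And>x. (\<lambda>b. psi_mf W P mu0 pis t b x) \<in> borel_measurable unit_lborel"
      and IH2: "\<And>x. AE b in unit_lborel. psi_mf W P mu0 pis t b x = tot t x b" by auto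
    note nb = nbhd_step[OF t IH1 IH2]
    have psi: "psi_mf W P mu0 pis (Suc t) b x =
        (\<Sum>x'\<in>UNIV. psi_mf W P mu0 pis t b x' * (\<Sum>u\<in>UNIV. pis b t x' u * P x' u (g b t) x))"
      if "b \<in> {0..1}" for b x
      using nb[OF that] by simp
    have "(\<lambda>b. \<Sum>x'\<in>UNIV. psi_mf W P mu0 pis t b x' * (\<Sum>u\<in>UNIV. pis b t x' u * P x' u (g b t) x))
        \<in> borel_measurable unit_lborel" for x
      by measurable
    then have "(\<lambda>b. psi_mf W P mu0 pis (Suc t) b x) \<in> borel_measurable unit_lborel" for x
      by (rule measurable_cong[THEN iffD1, rotated]) (use psi in simp)
    moreover have "AE b in unit_lborel. psi_mf W P mu0 pis (Suc t) b x = tot (Suc t) x b" for x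
    proof -
      have "AE b in unit_lborel. \<forall>x'. psi_mf W P mu0 pis t b x' = tot t x' b"
        using IH2 by (simp add: AE_all_countable)
      moreover have "AE b in unit_lborel. \<forall>x' u. tot t x' b * pis b t x' u = \<rho> t x' u b"
        using tot_pis by (simp add: AE_all_countable)
      moreover have "AE b in unit_lborel. b \<in> {0..1}" by (rule AE_I2) simp
      ultimately show ?thesis using flow[of t x]
      proof eventually_elim
        case (elim b)
        have "psi_mf W P mu0 pis (Suc t) b x =
            (\<Sum>x'\<in>UNIV. \<Sum>u\<in>UNIV. (tot t x' b * pis b t x' u) * P x' u (g b t) x)"
          unfolding psi[OF elim(3)] using elim(1) by (simp add: sum_distrib_left mult.assoc)
        also have "\<dots> = tot (Suc t) x b" using elim(2,4) by (simp add: tot_def)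
        finally show ?case .
      qed
    qed
    ultimately show ?case by blast
  qed
  have nb: "nbhd W (psi_mf W P mu0 pis t) a = g a t" if "t < T" "a \<in> {0..1}" for t a
    using nbhd_step[OF that(1) _ _ that(2)] main[OF that(1)] by blast
  have psi_prob: "prob_vec (psi_mf W P mu0 pis t a)" if "t < T" "a \<in> {0..1}" for t a
  proof -
    \<comment> \<open>Once the field is known to be \<open>g a\<close> at every earlier time, the
      ensemble evolves as a single-agent law, so it is a probability vector for every
      \<open>a\<close> and not just almost every one.\<close>
    have "psi_mf W P mu0 pis t a = law (g a) (pis a) t"
      by (subst psi_mf_eq, rule law_cong) (use nb that in auto)
    then show ?thesis using law_prob[OF g_feas[OF that(2)]] pis_prob by metis
  qed
  have pol: "is_policy T (pis a)" for a using pis_prob by (simp add: is_policy_def)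
  have "is_GMFE W P r mu0 T pis mus"
    unfolding is_GMFE_def
  proof (intro conjI ballI allI impI)
    show "is_policy_ensemble T pis"
      using pol pis_meas by (auto simp: is_policy_ensemble_def)
    show "is_mf_ensemble T mus"
      using psi_prob main by (auto simp: is_mf_ensemble_def mus_def)
    show "mus a t = psi_mf W P mu0 pis t a" for a t by (simp add: mus_def)
    fix a :: real and pol' :: "nat \<Rightarrow> 'x \<Rightarrow> 'u \<Rightarrow> real" assume a: "a \<in> {0..1}" and pol': "is_policy T pol'"
    show "J_obj W P r mu0 T mus a pol' \<le> J_obj W P r mu0 T mus a (pis a)"
      by (rule greedy_optimal[OF g_feas[OF a] pol pol' pis_gap])
        (use nb a in \<open>simp add: mus_def\<close>)
  qed
  then show ?thesis by blast
qed

end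

theorem theorem1:
  fixes P :: "'x::finite \<Rightarrow> 'u::finite \<Rightarrow> ('x \<Rightarrow> real) \<Rightarrow> ('x \<Rightarrow> real)"
    and r :: "'x \<Rightarrow> 'u \<Rightarrow> ('x \<Rightarrow> real) \<Rightarrow> real"
    and mu0 :: "'x \<Rightarrow> real"
    and W :: "real \<Rightarrow> real \<Rightarrow> real"
    and T :: nat
    and L_r L_P L_W :: real
  assumes "prob_vec mu0"
    and "\<And>x u g. bmeas_vec g \<Longrightarrow> prob_vec (P x u g)"
    and "graphon W"
    and "L_r > 0" and "L_P > 0" and "L_W > 0"
    and "reward_lipschitz L_r r"
    and "kernel_lipschitz L_P P"
    and "L_W-lipschitz_on ({0..1} \<times> {0..1}) (\<lambda>p. W (fst p) (snd p))"
  shows "\<exists>pis mus. is_GMFE W P r mu0 T pis mus"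
proof -
  interpret graphon_game P r mu0 W T L_r L_P L_W
    by unfold_locales (use assms in auto)
  show ?thesis by (rule GMFE_exists)
qed

end
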